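(* There exists an absolute constant $c>0$ such that for every $n\ge 1$, every ellipsoid $E$ in $\mathbf{R}^n$, every orthonormal basis $\{e_1,\ldots,e_n\}$ of $\mathbf{R}^n$ and every $\theta\in(0,1)$ there exists $\sigma\subseteq\{1,\ldots,n\}$ with $|\sigma|\ge(1-\theta)n$ such that $$\mathcal{P}_{\sigma}(E)\supseteq\frac{c\sqrt{\theta}}{\log^{1/2}\left(\frac{2}{\theta}\right)M_E}\,D_{\sigma}.$$
   Context: $\mathbf{R}^n$ carries an inner product $\langle\cdot,\cdot\rangle$ with Euclidean norm $|\cdot|$, unit ball $D_n$ and unit sphere $S^{n-1}$. An ellipsoid in $\mathbf{R}^n$ is a (non-degenerate, origin-centred) set $T^{-1}(D_n)$ with $T:\mathbf{R}^n\to\mathbf{R}^n$ a linear isomorphism. For a symmetric convex body $K$ with induced norm (gauge) $\|\cdot\|_K$, $M_K=\left(\int_{S^{n-1}}\|x\|_K^2\,d\mu(x)\right)^{1/2}$, where $\mu$ is the rotationally invariant probability measure on $S^{n-1}$. For $\sigma\subseteq\{1,\ldots,n\}$, $|\sigma|$ is its cardinality, $\mathbf{R}^{\sigma}=\{x\in\mathbf{R}^n:\langle x,e_j\rangle=0\text{ if }j\notin\sigma\}$ is the coordinate subspace, $\mathcal{P}_{\sigma}$ is the orthogonal projection onto $\mathbf{R}^{\sigma}$, and $D_{\sigma}=D_n\cap\mathbf{R}^{\sigma}$. *)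

theory Defs
  imports "HOL-Probability.Probability" "Jordan_Normal_Form.Determinant"
begin

unbundle no inner_syntax and no vec_syntax

text \<open>
  The constant in the theorem must not depend on the dimension \<open>n\<close>, so \<open>n\<close> has to be a term and
  not a type: Euclidean \<open>n\<close>-space is \<^term>\<open>carrier_vec n :: real Matrix.vec set\<close> with the standard
  inner product \<^term>\<open>scalar_prod\<close>, and coordinates are indexed by \<open>{..<n}\<close>.
\<close>

definition vnorm :: "real Matrix.vec \<Rightarrow> real" where
  "vnorm x = sqrt (x \<bullet> x)"

definition unit_ball :: "nat \<Rightarrow> real Matrix.vec set" where
  "unit_ball n = {x \<in> carrier_vec n. vnorm x \<le> 1}"

definition unit_sphere :: "nat \<Rightarrow> real Matrix.vec set" where
  "unit_sphere n = {x \<in> carrier_vec n. vnorm x = 1}"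

definition ellipsoid :: "nat \<Rightarrow> real Matrix.vec set \<Rightarrow> bool" where
  "ellipsoid n E \<longleftrightarrow>
    (\<exists>T \<in> carrier_mat n n. invertible_mat T \<and> E = {x \<in> carrier_vec n. T *\<^sub>v x \<in> unit_ball n})"

definition gauge_norm :: "real Matrix.vec set \<Rightarrow> real Matrix.vec \<Rightarrow> real" where
  "gauge_norm K x = Inf {t. 0 < t \<and> (\<exists>y \<in> K. x = t \<cdot>\<^sub>v y)}"

text \<open>Lebesgue measure on the Borel sets of \<open>n\<close>-space.\<close>

definition lborel_vec :: "nat \<Rightarrow> real Matrix.vec measure" where
  "lborel_vec n = embed_measure (Pi\<^sub>M {..<n} (\<lambda>_. lborel)) (Matrix.vec n)"

text \<open>
  The rotation invariant probability measure on the sphere, constructed as the radial projection of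
  the uniform distribution on the punctured unit ball. The theorem \<open>sphere_measure\<close> at the end of
  this theory proves that it is a rotation invariant probability measure for \<open>n > 0\<close>.
\<close>

definition punctured_ball :: "nat \<Rightarrow> real Matrix.vec set" where
  "punctured_ball n = unit_ball n - {0\<^sub>v n}"

definition sphere_measure :: "nat \<Rightarrow> real Matrix.vec measure" where
  "sphere_measure n =
    distr (uniform_measure (restrict_space (lborel_vec n) (punctured_ball n)) (punctured_ball n))
      (restrict_space (lborel_vec n) (unit_sphere n)) (\<lambda>x. (1 / vnorm x) \<cdot>\<^sub>v x)"

definition M_norm :: "nat \<Rightarrow> real Matrix.vec set \<Rightarrow> real" where
  "M_norm n K = sqrt (LINT x|sphere_measure n. (gauge_norm K x)\<^sup>2)"

text \<open>Being a basis is automatic for \<open>n\<close> orthonormal vectors in \<open>n\<close>-space.\<close>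

definition orthonormal_basis :: "nat \<Rightarrow> (nat \<Rightarrow> real Matrix.vec) \<Rightarrow> bool" where
  "orthonormal_basis n e \<longleftrightarrow>
    (\<forall>j<n. e j \<in> carrier_vec n) \<and> (\<forall>i<n. \<forall>j<n. e i \<bullet> e j = (if i = j then 1 else 0))"

definition coord_subspace ::
    "nat \<Rightarrow> (nat \<Rightarrow> real Matrix.vec) \<Rightarrow> nat set \<Rightarrow> real Matrix.vec set" where
  "coord_subspace n e \<sigma> = {x \<in> carrier_vec n. \<forall>j<n. j \<notin> \<sigma> \<longrightarrow> x \<bullet> e j = 0}"

definition orth_proj :: "real Matrix.vec set \<Rightarrow> real Matrix.vec \<Rightarrow> real Matrix.vec" where
  "orth_proj V x = (THE y. y \<in> V \<and> (\<forall>v \<in> V. (x - y) \<bullet> v = 0))"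

definition coord_ball ::
    "nat \<Rightarrow> (nat \<Rightarrow> real Matrix.vec) \<Rightarrow> nat set \<Rightarrow> real Matrix.vec set" where
  "coord_ball n e \<sigma> = unit_ball n \<inter> coord_subspace n e \<sigma>"

lemma space_lborel_vec [simp]: "space (lborel_vec n) = carrier_vec n"
proof -
  have "x \<in> Matrix.vec n ` (\<Pi>\<^sub>E i\<in>{..<n}. UNIV)" if "x \<in> carrier_vec n" for x :: "real Matrix.vec"
    using that by (intro image_eqI[where x = "restrict (($) x) {..<n}"]) auto
  then show ?thesis
    by (auto simp: lborel_vec_def space_embed_measure space_PiM)
qed

lemma inj_on_vec: "inj_on (Matrix.vec n) (space (Pi\<^sub>M {..<n} (\<lambda>_. lborel :: real measure)))"
proof (rule inj_onI)
  fix x y :: "nat \<Rightarrow> real"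
  assume "x \<in> space (Pi\<^sub>M {..<n} (\<lambda>_. lborel))" "y \<in> space (Pi\<^sub>M {..<n} (\<lambda>_. lborel))"
    and eq: "Matrix.vec n x = Matrix.vec n y"
  moreover have "x i = y i" if "i < n" for i
    using arg_cong[OF eq, of "\<lambda>v. v $ i"] that by simp
  ultimately show "x = y"
    by (intro PiE_ext[where k = "{..<n}"]) (auto simp: space_PiM)
qed

lemma vec_measurable: "Matrix.vec n \<in> Pi\<^sub>M {..<n} (\<lambda>_. lborel) \<rightarrow>\<^sub>M lborel_vec n"
  unfolding lborel_vec_def by (rule measurable_embed_measure2'[OF inj_on_vec])

lemma lborel_vec_eq_distr:
  "lborel_vec n = distr (Pi\<^sub>M {..<n} (\<lambda>_. lborel)) (lborel_vec n) (Matrix.vec n)"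
  unfolding lborel_vec_def by (rule embed_measure_eq_distr'[OF inj_on_vec])

lemma measurable_vec_index: "i < n \<Longrightarrow> (\<lambda>x. x $ i) \<in> borel_measurable (lborel_vec n)"
  unfolding lborel_vec_def by (rule measurable_embed_measure1) simp

lemma measurable_lborel_vecI:
  assumes "\<And>x. x \<in> space X \<Longrightarrow> F x \<in> carrier_vec n"
    and "\<And>i. i < n \<Longrightarrow> (\<lambda>x. F x $ i) \<in> borel_measurable X"
  shows "F \<in> X \<rightarrow>\<^sub>M lborel_vec n"
proof -
  have "(\<lambda>x. Matrix.vec n (\<lambda>i\<in>{..<n}. F x $ i)) \<in> X \<rightarrow>\<^sub>M lborel_vec n"
    using assms(2)
    by (intro measurable_compose[OF _ vec_measurable] measurable_restrict) auto
  moreover have "Matrix.vec n (\<lambda>i\<in>{..<n}. F x $ i) = F x" if "x \<in> space X" for x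
    using assms(1)[OF that] by auto
  ultimately show ?thesis
    by (subst measurable_cong[of X F "\<lambda>x. Matrix.vec n (\<lambda>i\<in>{..<n}. F x $ i)"]) auto
qed

lemma measurable_scalar_prod:
  assumes "F \<in> X \<rightarrow>\<^sub>M lborel_vec n" "G \<in> X \<rightarrow>\<^sub>M lborel_vec n"
  shows "(\<lambda>x. F x \<bullet> G x) \<in> borel_measurable X"
proof -
  have "(\<lambda>x. \<Sum>i<n. F x $ i * G x $ i) \<in> borel_measurable X"
    using assms by (intro borel_measurable_sum borel_measurable_times)
      (auto intro: measurable_compose[OF _ measurable_vec_index])
  moreover have "F x \<bullet> G x = (\<Sum>i<n. F x $ i * G x $ i)" if "x \<in> space X" for x
    using measurable_space[OF assms(2) that] by (auto simp: scalar_prod_def lessThan_atLeast0)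
  ultimately show ?thesis
    by (subst measurable_cong[of X _ "\<lambda>x. \<Sum>i<n. F x $ i * G x $ i"]) auto
qed

lemma measurable_vnorm: "F \<in> X \<rightarrow>\<^sub>M lborel_vec n \<Longrightarrow> (\<lambda>x. vnorm (F x)) \<in> borel_measurable X"
  unfolding vnorm_def
  by (intro measurable_compose[OF _ borel_measurable_sqrt] measurable_scalar_prod)

lemma measurable_add_vec:
  assumes "F \<in> X \<rightarrow>\<^sub>M lborel_vec n" "G \<in> X \<rightarrow>\<^sub>M lborel_vec n"
  shows "(\<lambda>x. F x + G x) \<in> X \<rightarrow>\<^sub>M lborel_vec n"
proof (rule measurable_lborel_vecI)
  show "F x + G x \<in> carrier_vec n" if "x \<in> space X" for x
    using assms[THEN measurable_space, OF that] by simp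
  fix i assume i: "i < n"
  have "(\<lambda>x. F x $ i + G x $ i) \<in> borel_measurable X"
    using assms i by (intro borel_measurable_add) (auto intro: measurable_compose[OF _ measurable_vec_index])
  moreover have "(F x + G x) $ i = F x $ i + G x $ i" if "x \<in> space X" for x
    using measurable_space[OF assms(2) that] i by auto
  ultimately show "(\<lambda>x. (F x + G x) $ i) \<in> borel_measurable X"
    by (subst measurable_cong[of X _ "\<lambda>x. F x $ i + G x $ i"]) auto
qed

lemma measurable_smult_vec:
  assumes "F \<in> X \<rightarrow>\<^sub>M lborel_vec n" "g \<in> borel_measurable X"
  shows "(\<lambda>x. g x \<cdot>\<^sub>v F x) \<in> X \<rightarrow>\<^sub>M lborel_vec n"
proof (rule measurable_lborel_vecI)
  show "g x \<cdot>\<^sub>v F x \<in> carrier_vec n" if "x \<in> space X" for x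
    using measurable_space[OF assms(1) that] by simp
  fix i assume i: "i < n"
  have "(\<lambda>x. g x * F x $ i) \<in> borel_measurable X"
    using assms i by (intro borel_measurable_times) (auto intro: measurable_compose[OF _ measurable_vec_index])
  moreover have "(g x \<cdot>\<^sub>v F x) $ i = g x * F x $ i" if "x \<in> space X" for x
    using measurable_space[OF assms(1) that] i by auto
  ultimately show "(\<lambda>x. (g x \<cdot>\<^sub>v F x) $ i) \<in> borel_measurable X"
    by (subst measurable_cong[of X _ "\<lambda>x. g x * F x $ i"]) auto
qed

lemma measurable_mult_mat_vec:
  assumes "A \<in> carrier_mat n n" "F \<in> X \<rightarrow>\<^sub>M lborel_vec n"
  shows "(\<lambda>x. A *\<^sub>v F x) \<in> X \<rightarrow>\<^sub>M lborel_vec n"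
proof (rule measurable_lborel_vecI)
  show "A *\<^sub>v F x \<in> carrier_vec n" if "x \<in> space X" for x
    using assms(1) measurable_space[OF assms(2) that] by simp
  fix i assume i: "i < n"
  have "(\<lambda>x. row A i \<bullet> F x) \<in> borel_measurable X"
    using assms i by (intro measurable_scalar_prod[where n = n] measurable_const) auto
  then show "(\<lambda>x. (A *\<^sub>v F x) $ i) \<in> borel_measurable X"
    using assms(1) i by simp
qed

lemma sets_unit_ball: "unit_ball n \<in> sets (lborel_vec n)"
proof -
  have "unit_ball n = vnorm -` {..1} \<inter> space (lborel_vec n)"
    by (auto simp: unit_ball_def)
  then show ?thesis
    using measurable_sets[OF measurable_vnorm[OF measurable_ident_sets[OF refl, of "lborel_vec n"]]]
    by simp
qed

lemma sets_unit_sphere: "unit_sphere n \<in> sets (lborel_vec n)"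
proof -
  have "unit_sphere n = vnorm -` {1} \<inter> space (lborel_vec n)"
    by (auto simp: unit_sphere_def)
  then show ?thesis
    using measurable_sets[OF measurable_vnorm[OF measurable_ident_sets[OF refl, of "lborel_vec n"]]]
    by simp
qed

lemma vnorm_eq_0_iff: "x \<in> carrier_vec n \<Longrightarrow> vnorm x = 0 \<longleftrightarrow> x = 0\<^sub>v n"
proof -
  assume x: "x \<in> carrier_vec n"
  have "x \<bullet> x = 0 \<longleftrightarrow> (\<forall>i<n. x $ i = 0)"
    using x by (auto simp: scalar_prod_def sum_nonneg_eq_0_iff)
  then show "vnorm x = 0 \<longleftrightarrow> x = 0\<^sub>v n"
    using x by (auto simp: vnorm_def)
qed

lemma sets_zero_vec: "{0\<^sub>v n} \<in> sets (lborel_vec n)"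
proof -
  have "{0\<^sub>v n} = vnorm -` {0} \<inter> space (lborel_vec n)"
    using vnorm_eq_0_iff[of _ n] by auto
  then show ?thesis
    using measurable_sets[OF measurable_vnorm[OF measurable_ident_sets[OF refl, of "lborel_vec n"]]]
    by simp
qed

lemma sets_punctured_ball: "punctured_ball n \<in> sets (lborel_vec n)"
  unfolding punctured_ball_def using sets_unit_ball sets_zero_vec by (rule sets.Diff)

lemma sets_lborel_vec_box:
  assumes "\<And>i. i < n \<Longrightarrow> B i \<in> sets borel"
  shows "{x \<in> carrier_vec n. \<forall>i<n. x $ i \<in> B i} \<in> sets (lborel_vec n)"
proof (cases "n = 0")
  case True
  then show ?thesis
    using sets.top[of "lborel_vec n"] by simp
next
  case False
  have "{x \<in> carrier_vec n. \<forall>i<n. x $ i \<in> B i} =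
      (\<Inter>i\<in>{..<n}. (\<lambda>x. x $ i) -` B i \<inter> space (lborel_vec n))"
    using False by auto
  also have "\<dots> \<in> sets (lborel_vec n)"
    using assms False by (intro sets.finite_INT measurable_sets[OF measurable_vec_index]) auto
  finally show ?thesis .
qed

lemma emeasure_lborel_vec_box:
  assumes "\<And>i. i < n \<Longrightarrow> B i \<in> sets borel"
  shows "emeasure (lborel_vec n) {x \<in> carrier_vec n. \<forall>i<n. x $ i \<in> B i} =
    (\<Prod>i<n. emeasure lborel (B i))"
proof -
  interpret product_sigma_finite "\<lambda>_. lborel :: real measure"
    by standard
  let ?P = "Pi\<^sub>M {..<n} (\<lambda>_. lborel :: real measure)"
  let ?B = "{x \<in> carrier_vec n. \<forall>i<n. x $ i \<in> B i}"
  have "emeasure (lborel_vec n) ?B = emeasure ?P (Matrix.vec n -` ?B \<inter> space ?P)"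
    by (subst lborel_vec_eq_distr) (rule emeasure_distr[OF vec_measurable sets_lborel_vec_box[OF assms]])
  also have "Matrix.vec n -` ?B \<inter> space ?P = Pi\<^sub>E {..<n} B"
    by (auto simp: space_PiM PiE_iff)
  also have "emeasure ?P \<dots> = (\<Prod>i<n. emeasure lborel (B i))"
    using assms by (intro emeasure_PiM) auto
  finally show ?thesis .
qed

lemma sigma_finite_lborel_vec: "sigma_finite_measure (lborel_vec n)"
proof
  define Q where "Q k = {x \<in> carrier_vec n. \<forall>i<n. x $ i \<in> {- real k..real k}}" for k
  have "\<exists>k. x \<in> Q k" if "x \<in> carrier_vec n" for x
  proof -
    obtain k where k: "(\<Sum>i<n. \<bar>x $ i\<bar>) \<le> real k"
      using real_arch_simple by blast
    have "\<bar>x $ i\<bar> \<le> real k" if "i < n" for i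
      using member_le_sum[of i "{..<n}" "\<lambda>i. \<bar>x $ i\<bar>"] that k by simp
    then have "x \<in> Q k"
      using \<open>x \<in> carrier_vec n\<close> by (auto simp: Q_def abs_le_iff minus_le_iff)
    then show ?thesis ..
  qed
  moreover have "Q k \<subseteq> carrier_vec n" for k
    by (auto simp: Q_def)
  ultimately have "\<Union>(range Q) = carrier_vec n"
    by blast
  moreover have "emeasure (lborel_vec n) (Q k) \<noteq> \<infinity>" for k
    unfolding Q_def by (subst emeasure_lborel_vec_box) (auto simp: ennreal_power)
  moreover have "Q k \<in> sets (lborel_vec n)" for k
    unfolding Q_def by (rule sets_lborel_vec_box) simp
  ultimately show "\<exists>A. countable A \<and> A \<subseteq> sets (lborel_vec n) \<and> \<Union>A = space (lborel_vec n) \<and>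
      (\<forall>a\<in>A. emeasure (lborel_vec n) a \<noteq> \<infinity>)"
    by (intro exI[of _ "range Q"]) auto
qed

lemma emeasure_unit_ball_finite: "emeasure (lborel_vec n) (unit_ball n) < \<infinity>"
proof -
  have "x $ i \<in> {-1..1}" if x: "x \<in> unit_ball n" and i: "i < n" for x i
  proof -
    have "(x $ i)\<^sup>2 \<le> (\<Sum>j = 0..<n. (x $ j)\<^sup>2)"
      using i by (intro member_le_sum) auto
    also have "\<dots> = x \<bullet> x"
      using x by (auto simp: unit_ball_def scalar_prod_def power2_eq_square)
    also have "\<dots> \<le> 1"
      using x by (simp add: unit_ball_def vnorm_def)
    finally show ?thesis
      by (simp add: abs_square_le_1 abs_le_iff)
  qed
  then have sub: "unit_ball n \<subseteq> {x \<in> carrier_vec n. \<forall>i<n. x $ i \<in> {-1..1}}"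
    by (auto simp: unit_ball_def)
  have box: "emeasure (lborel_vec n) {x \<in> carrier_vec n. \<forall>i<n. x $ i \<in> {-1..1}} = (\<Prod>i<n. 2)"
    by (subst emeasure_lborel_vec_box) auto
  have "emeasure (lborel_vec n) (unit_ball n) \<le> (\<Prod>i<n. 2)"
    unfolding box[symmetric] by (intro emeasure_mono sub sets_lborel_vec_box) simp
  also have "(\<Prod>i<n. 2::ennreal) < \<infinity>"
    by (simp add: power_less_top_ennreal)
  finally show ?thesis .
qed

lemma emeasure_unit_ball_pos: "emeasure (lborel_vec n) (unit_ball n) > 0"
proof -
  define r where "r = 1 / real (n + 1)"
  have r: "0 < r" by (simp add: r_def)
  have sub: "{x \<in> carrier_vec n. \<forall>i<n. x $ i \<in> {-r..r}} \<subseteq> unit_ball n"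
  proof clarify
    fix x :: "real Matrix.vec"
    assume x: "x \<in> carrier_vec n" "\<forall>i<n. x $ i \<in> {-r..r}"
    have "x \<bullet> x = (\<Sum>i = 0..<n. (x $ i)\<^sup>2)"
      using x(1) by (simp add: scalar_prod_def power2_eq_square)
    also have "\<dots> \<le> (\<Sum>i = 0..<n. r\<^sup>2)"
      using x(2) by (intro sum_mono) (auto simp: abs_le_square_iff[symmetric])
    also have "\<dots> = real n / (real n + 1)\<^sup>2"
      by (simp add: r_def power_divide add.commute)
    also have "\<dots> \<le> 1"
      by (simp add: divide_le_eq power2_eq_square algebra_simps)
    finally show "x \<in> unit_ball n"
      using x(1) by (simp add: unit_ball_def vnorm_def)
  qed
  have "0 < (\<Prod>i<n. ennreal (2 * r))"
    using r by (simp add: ennreal_power)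
  also have "\<dots> = emeasure (lborel_vec n) {x \<in> carrier_vec n. \<forall>i<n. x $ i \<in> {-r..r}}"
    using r by (subst emeasure_lborel_vec_box) auto
  also have "\<dots> \<le> emeasure (lborel_vec n) (unit_ball n)"
    using sub sets_unit_ball by (rule emeasure_mono)
  finally show ?thesis .
qed

lemma emeasure_punctured_ball:
  assumes "0 < n"
  shows "emeasure (lborel_vec n) (punctured_ball n) = emeasure (lborel_vec n) (unit_ball n)"
proof -
  have "{0\<^sub>v n} = {x \<in> carrier_vec n. \<forall>i<n. x $ i \<in> {0::real}}"
    by auto
  then have "emeasure (lborel_vec n) {0\<^sub>v n} = 0"
    using assms by (simp add: emeasure_lborel_vec_box[where B = "\<lambda>_. {0}", simplified])
  then show ?thesis
    unfolding punctured_ball_def by (intro emeasure_Diff_null_set) (auto simp: null_sets_def sets_zero_vec sets_unit_ball)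
qed

lemma distr_lborel_vec_translate:
  assumes "a \<in> carrier_vec n"
  shows "distr (lborel_vec n) (lborel_vec n) (\<lambda>x. a + x) = lborel_vec n"
proof -
  interpret product_sigma_finite "\<lambda>_. lborel :: real measure"
    by standard
  let ?P = "Pi\<^sub>M {..<n} (\<lambda>_. lborel :: real measure)"
  define \<tau> where "\<tau> = (\<lambda>x. \<lambda>i\<in>{..<n}. a $ i + x i)"
  have \<tau>: "\<tau> \<in> ?P \<rightarrow>\<^sub>M ?P"
    unfolding \<tau>_def by (intro measurable_restrict) auto
  have "?P = distr ?P ?P \<tau>"
  proof (rule PiM_eqI[symmetric])
    fix A :: "nat \<Rightarrow> real set" assume A: "\<And>i. i \<in> {..<n} \<Longrightarrow> A i \<in> sets lborel"
    have "emeasure (distr ?P ?P \<tau>) (Pi\<^sub>E {..<n} A) = emeasure ?P (\<tau> -` Pi\<^sub>E {..<n} A \<inter> space ?P)"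
      using A by (intro emeasure_distr \<tau> sets_PiM_I_finite) auto
    also have "\<tau> -` Pi\<^sub>E {..<n} A \<inter> space ?P = (\<Pi>\<^sub>E i\<in>{..<n}. (\<lambda>t. a $ i + t) -` A i)"
      by (auto simp: \<tau>_def space_PiM PiE_iff)
    also have "emeasure ?P \<dots> = (\<Prod>i<n. emeasure lborel ((\<lambda>t. a $ i + t) -` A i))"
      using A by (intro emeasure_PiM) (auto intro!: measurable_sets_borel[where M = borel])
    also have "\<dots> = (\<Prod>i<n. emeasure lborel (A i))"
    proof (intro prod.cong refl)
      fix i assume "i \<in> {..<n}"
      then have "emeasure (distr lborel borel (\<lambda>t. a $ i + t)) (A i) =
          emeasure lborel ((\<lambda>t. a $ i + t) -` A i)"
        using A by (simp add: emeasure_distr)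
      then show "emeasure lborel ((\<lambda>t. a $ i + t) -` A i) = emeasure lborel (A i)"
        by (simp add: lborel_distr_plus)
    qed
    finally show "emeasure (distr ?P ?P \<tau>) (Pi\<^sub>E {..<n} A) = (\<Prod>i<n. emeasure lborel (A i))" .
  qed auto
  then have "lborel_vec n = distr (distr ?P ?P \<tau>) (lborel_vec n) (Matrix.vec n)"
    using lborel_vec_eq_distr by metis
  also have "\<dots> = distr ?P (lborel_vec n) (Matrix.vec n \<circ> \<tau>)"
    by (rule distr_distr[OF vec_measurable \<tau>])
  also have "\<dots> = distr ?P (lborel_vec n) ((\<lambda>x. a + x) \<circ> Matrix.vec n)"
    using assms by (intro distr_cong) (auto simp: \<tau>_def)
  also have "\<dots> = distr (distr ?P (lborel_vec n) (Matrix.vec n)) (lborel_vec n) (\<lambda>x. a + x)"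
    using assms
    by (intro distr_distr[symmetric] vec_measurable measurable_add_vec measurable_const) auto
  finally show ?thesis
    using lborel_vec_eq_distr by metis
qed

lemma nn_integral_lborel_vec_translate:
  assumes "a \<in> carrier_vec n" "f \<in> borel_measurable (lborel_vec n)"
  shows "(\<integral>\<^sup>+x. f (a + x) \<partial>lborel_vec n) = (\<integral>\<^sup>+x. f x \<partial>lborel_vec n)"
proof -
  have "(\<integral>\<^sup>+x. f x \<partial>lborel_vec n) =
      (\<integral>\<^sup>+x. f x \<partial>distr (lborel_vec n) (lborel_vec n) (\<lambda>x. a + x))"
    using distr_lborel_vec_translate[OF assms(1)] by simp
  also have "\<dots> = (\<integral>\<^sup>+x. f (a + x) \<partial>lborel_vec n)"
    using assms by (intro nn_integral_distr measurable_add_vec measurable_const) auto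
  finally show ?thesis by simp
qed

text \<open>Rotation invariance is meant with respect to the full orthogonal group.\<close>

definition rotation :: "nat \<Rightarrow> real mat \<Rightarrow> bool" where
  "rotation n U \<longleftrightarrow> U \<in> carrier_mat n n \<and> transpose_mat U * U = 1\<^sub>m n"

lemma rotation_mult_transpose:
  assumes "rotation n U"
  shows "U * transpose_mat U = 1\<^sub>m n"
  using assms mat_mult_left_right_inverse[of "transpose_mat U" n U] by (auto simp: rotation_def)

lemma rotation_transpose: "rotation n U \<Longrightarrow> rotation n (transpose_mat U)"
  using rotation_mult_transpose by (auto simp: rotation_def)

lemma vnorm_rotation:
  assumes "rotation n U" "x \<in> carrier_vec n"
  shows "vnorm (U *\<^sub>v x) = vnorm x"
proof -
  have U: "U \<in> carrier_mat n n" "transpose_mat U * U = 1\<^sub>m n"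
    using assms(1) by (auto simp: rotation_def)
  have "(U *\<^sub>v x) \<bullet> (U *\<^sub>v x) = (transpose_mat U *\<^sub>v (U *\<^sub>v x)) \<bullet> x"
    using U(1) assms(2) transpose_vec_mult_scalar[of U n n x "U *\<^sub>v x"]
    by (metis mult_mat_vec_carrier)
  also have "transpose_mat U *\<^sub>v (U *\<^sub>v x) = x"
    using U assms(2) assoc_mult_mat_vec[of "transpose_mat U" n n U n x] by simp
  finally show ?thesis
    by (simp add: vnorm_def)
qed

lemma emeasure_lborel_vec_rotation:
  assumes U: "rotation n U" and B: "B \<in> sets (lborel_vec n)"
  shows "emeasure (lborel_vec n) ((*\<^sub>v) U -` B \<inter> carrier_vec n) = emeasure (lborel_vec n) B"
proof -
  interpret L: sigma_finite_measure "lborel_vec n"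
    by (rule sigma_finite_lborel_vec)
  interpret LL: pair_sigma_finite "lborel_vec n" "lborel_vec n" ..
  let ?L = "lborel_vec n"
  have UC: "U \<in> carrier_mat n n" "transpose_mat U \<in> carrier_mat n n"
    using U by (auto simp: rotation_def)
  define D :: "real Matrix.vec \<Rightarrow> ennreal" where "D = indicator (unit_ball n)"
  define F :: "real Matrix.vec \<Rightarrow> ennreal" where "F = indicator B"
  have D: "D \<in> borel_measurable ?L" and F: "F \<in> borel_measurable ?L"
    using sets_unit_ball B by (auto simp: D_def F_def)
  have UTU: "transpose_mat U *\<^sub>v (U *\<^sub>v x) = x" "U *\<^sub>v (transpose_mat U *\<^sub>v x) = x"
    if "x \<in> carrier_vec n" for x
    using UC U rotation_mult_transpose[OF U] that
      assoc_mult_mat_vec[of "transpose_mat U" n n U n x] assoc_mult_mat_vec[of U n n "transpose_mat U" n x]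
    by (auto simp: rotation_def)
  have D_neg: "D (- x) = D x" if "x \<in> carrier_vec n" for x
    using that by (simp add: D_def indicator_def unit_ball_def vnorm_def)
  have D_rot: "D (U *\<^sub>v x) = D x" if "x \<in> carrier_vec n" for x
    using that UC vnorm_rotation[OF U that] by (simp add: D_def indicator_def unit_ball_def)
  have mU: "(*\<^sub>v) U \<in> ?L \<rightarrow>\<^sub>M ?L"
    using measurable_mult_mat_vec[OF UC(1) measurable_ident_sets[OF refl]] by simp
  have neg: "uminus \<in> ?L \<rightarrow>\<^sub>M ?L"
  proof -
    have "(\<lambda>x. (-1) \<cdot>\<^sub>v x) \<in> ?L \<rightarrow>\<^sub>M ?L"
      by (intro measurable_smult_vec) auto
    moreover have "- x = (-1) \<cdot>\<^sub>v x" for x :: "real Matrix.vec"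
      by auto
    ultimately show ?thesis by (simp cong: measurable_cong)
  qed
  have "(\<integral>\<^sup>+y. F (U *\<^sub>v y) \<partial>?L) * (\<integral>\<^sup>+x. D x \<partial>?L) =
      (\<integral>\<^sup>+x. (\<integral>\<^sup>+y. D x * F (U *\<^sub>v y) \<partial>?L) \<partial>?L)"
    using F D mU by (simp add: nn_integral_cmult nn_integral_multc mult.commute)
  also have "\<dots> = (\<integral>\<^sup>+x. (\<integral>\<^sup>+y. D x * F (x + U *\<^sub>v y) \<partial>?L) \<partial>?L)"
  proof (rule nn_integral_cong)
    fix x assume x: "x \<in> space ?L"
    have "(\<integral>\<^sup>+y. D x * F (U *\<^sub>v y) \<partial>?L) =
        (\<integral>\<^sup>+y. D x * F (U *\<^sub>v (transpose_mat U *\<^sub>v x + y)) \<partial>?L)"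
      using x UC F mU by (intro nn_integral_lborel_vec_translate[symmetric]) auto
    also have "\<dots> = (\<integral>\<^sup>+y. D x * F (x + U *\<^sub>v y) \<partial>?L)"
      using x UC by (intro nn_integral_cong) (simp add: mult_add_distrib_mat_vec[OF UC(1)] UTU)
    finally show "(\<integral>\<^sup>+y. D x * F (U *\<^sub>v y) \<partial>?L) = (\<integral>\<^sup>+y. D x * F (x + U *\<^sub>v y) \<partial>?L)" .
  qed
  also have "\<dots> = (\<integral>\<^sup>+y. (\<integral>\<^sup>+x. D x * F (x + U *\<^sub>v y) \<partial>?L) \<partial>?L)"
    using D F
    by (intro LL.Fubini'[symmetric])
      (simp add: case_prod_beta', intro borel_measurable_times_ennreal measurable_compose[OF _ D]
        measurable_compose[OF _ F] measurable_add_vec measurable_mult_mat_vec[OF UC(1)] measurable_fst measurable_snd)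
  also have "\<dots> = (\<integral>\<^sup>+y. (\<integral>\<^sup>+x. D (- (U *\<^sub>v y) + x) * F x \<partial>?L) \<partial>?L)"
  proof (rule nn_integral_cong)
    fix y assume y: "y \<in> space ?L"
    have Uy: "U *\<^sub>v y \<in> carrier_vec n" using y UC by auto
    have "(\<integral>\<^sup>+x. D (- (U *\<^sub>v y) + x) * F x \<partial>?L) =
        (\<integral>\<^sup>+x. D (- (U *\<^sub>v y) + (U *\<^sub>v y + x)) * F (U *\<^sub>v y + x) \<partial>?L)"
      using Uy F
      by (intro nn_integral_lborel_vec_translate[symmetric] borel_measurable_times_ennreal
          measurable_compose[OF _ D] measurable_add_vec measurable_const) auto
    also have "\<dots> = (\<integral>\<^sup>+x. D x * F (x + U *\<^sub>v y) \<partial>?L)"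
    proof (rule nn_integral_cong)
      fix x assume "x \<in> space ?L"
      then have x: "x \<in> carrier_vec n" by simp
      have "- (U *\<^sub>v y) + (U *\<^sub>v y + x) = x"
        by (rule eq_vecI) (use x Uy UC in \<open>auto simp del: index_mult_mat_vec\<close>)
      moreover have "U *\<^sub>v y + x = x + U *\<^sub>v y"
        using Uy x by (rule comm_add_vec)
      ultimately show "D (- (U *\<^sub>v y) + (U *\<^sub>v y + x)) * F (U *\<^sub>v y + x) = D x * F (x + U *\<^sub>v y)"
        by simp
    qed
    finally show "(\<integral>\<^sup>+x. D x * F (x + U *\<^sub>v y) \<partial>?L) = (\<integral>\<^sup>+x. D (- (U *\<^sub>v y) + x) * F x \<partial>?L)" ..
  qed
  also have "\<dots> = (\<integral>\<^sup>+x. (\<integral>\<^sup>+y. D (- (U *\<^sub>v y) + x) * F x \<partial>?L) \<partial>?L)"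
    using D F
    by (intro LL.Fubini')
      (simp add: case_prod_beta', intro borel_measurable_times_ennreal measurable_compose[OF _ D]
        measurable_compose[OF _ F] measurable_add_vec measurable_compose[OF _ neg]
        measurable_mult_mat_vec[OF UC(1)] measurable_fst measurable_snd)
  also have "\<dots> = (\<integral>\<^sup>+x. (\<integral>\<^sup>+y. D y * F x \<partial>?L) \<partial>?L)"
  proof (rule nn_integral_cong)
    fix x assume x: "x \<in> space ?L"
    have Ux: "transpose_mat U *\<^sub>v x \<in> carrier_vec n" using x UC by auto
    have "(\<integral>\<^sup>+y. D (- (U *\<^sub>v y) + x) * F x \<partial>?L) =
        (\<integral>\<^sup>+y. D (- (U *\<^sub>v (transpose_mat U *\<^sub>v x + y)) + x) * F x \<partial>?L)"
      using Ux x F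
      by (intro nn_integral_lborel_vec_translate[symmetric] borel_measurable_times_ennreal
          measurable_compose[OF _ D] measurable_add_vec measurable_compose[OF _ neg]
        measurable_mult_mat_vec[OF UC(1)] measurable_const) auto
    also have "\<dots> = (\<integral>\<^sup>+y. D y * F x \<partial>?L)"
    proof (rule nn_integral_cong)
      fix y assume "y \<in> space ?L"
      then have y: "y \<in> carrier_vec n" by simp
      have "- (U *\<^sub>v (transpose_mat U *\<^sub>v x + y)) + x = - (x + U *\<^sub>v y) + x"
        using x y Ux by (simp add: mult_add_distrib_mat_vec[OF UC(1)] UTU)
      also have "\<dots> = - (U *\<^sub>v y)"
        by (rule eq_vecI) (use x y UC in \<open>auto simp del: index_mult_mat_vec\<close>)
      finally show "D (- (U *\<^sub>v (transpose_mat U *\<^sub>v x + y)) + x) * F x = D y * F x"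
        using y UC by (simp add: D_neg D_rot)
    qed
    finally show "(\<integral>\<^sup>+y. D (- (U *\<^sub>v y) + x) * F x \<partial>?L) = (\<integral>\<^sup>+y. D y * F x \<partial>?L)" .
  qed
  also have "\<dots> = (\<integral>\<^sup>+x. F x \<partial>?L) * (\<integral>\<^sup>+x. D x \<partial>?L)"
    using F D by (simp add: nn_integral_cmult nn_integral_multc mult.commute)
  finally have eq: "(\<integral>\<^sup>+y. F (U *\<^sub>v y) \<partial>?L) * (\<integral>\<^sup>+x. D x \<partial>?L) =
      (\<integral>\<^sup>+x. F x \<partial>?L) * (\<integral>\<^sup>+x. D x \<partial>?L)" .
  have ball_D: "(\<integral>\<^sup>+x. D x \<partial>?L) = emeasure ?L (unit_ball n)"
    using sets_unit_ball by (simp add: D_def)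
  have cancel: "a = b" if "a * c = b * c" "c > 0" "c < \<infinity>" for a b c :: ennreal
    using that(1) that(2,3)[THEN less_imp_neq] ennreal_mult_cancel_left[of c a b]
    by (simp add: mult.commute)
  have "(\<integral>\<^sup>+y. F (U *\<^sub>v y) \<partial>?L) = (\<integral>\<^sup>+x. F x \<partial>?L)"
    by (rule cancel[OF eq]) (simp_all add: ball_D emeasure_unit_ball_pos emeasure_unit_ball_finite[simplified])
  moreover have "(\<integral>\<^sup>+y. F (U *\<^sub>v y) \<partial>?L) =
      (\<integral>\<^sup>+y. indicator ((*\<^sub>v) U -` B \<inter> carrier_vec n) y \<partial>?L)"
    by (rule nn_integral_cong) (simp add: F_def indicator_def)
  moreover have "(\<integral>\<^sup>+x. F x \<partial>?L) = emeasure ?L B"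
    using B by (simp add: F_def)
  moreover have "(\<integral>\<^sup>+y. indicator ((*\<^sub>v) U -` B \<inter> carrier_vec n) y \<partial>?L) =
      emeasure ?L ((*\<^sub>v) U -` B \<inter> carrier_vec n)"
    using measurable_sets[OF mU B] by (intro nn_integral_indicator) simp
  ultimately show ?thesis
    by simp
qed

lemma normalize_measurable:
  "(\<lambda>x. (1 / vnorm x) \<cdot>\<^sub>v x) \<in>
    restrict_space (lborel_vec n) (punctured_ball n) \<rightarrow>\<^sub>M restrict_space (lborel_vec n) (unit_sphere n)"
proof (rule measurable_restrict_space2)
  have id: "(\<lambda>x. x) \<in> restrict_space (lborel_vec n) (punctured_ball n) \<rightarrow>\<^sub>M lborel_vec n"
    by (rule measurable_restrict_space1) simp
  then show "(\<lambda>x. (1 / vnorm x) \<cdot>\<^sub>v x) \<in> restrict_space (lborel_vec n) (punctured_ball n) \<rightarrow>\<^sub>M lborel_vec n"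
    by (intro measurable_smult_vec borel_measurable_divide measurable_vnorm) auto
  have "(1 / vnorm x) \<cdot>\<^sub>v x \<in> unit_sphere n" if "x \<in> punctured_ball n" for x
  proof -
    have x: "x \<in> carrier_vec n" "vnorm x \<noteq> 0"
      using that by (auto simp: punctured_ball_def unit_ball_def vnorm_eq_0_iff)
    have "vnorm ((1 / vnorm x) \<cdot>\<^sub>v x) = sqrt ((x \<bullet> x) / (vnorm x)\<^sup>2)"
      using x by (simp add: vnorm_def power2_eq_square)
    also have "\<dots> = 1"
      using x by (simp add: vnorm_def real_sqrt_divide scalar_prod_def sum_nonneg)
    finally show ?thesis
      using x by (simp add: unit_sphere_def)
  qed
  then show "(\<lambda>x. (1 / vnorm x) \<cdot>\<^sub>v x) \<in> space (restrict_space (lborel_vec n) (punctured_ball n)) \<rightarrow> unit_sphere n"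
    by (auto simp: space_restrict_space)
qed

theorem sphere_measure:
  assumes n: "0 < n"
  shows "prob_space (sphere_measure n)"
    and "space (sphere_measure n) = unit_sphere n"
    and "sets (sphere_measure n) = sets (restrict_space (lborel_vec n) (unit_sphere n))"
    and "rotation n U \<Longrightarrow> distr (sphere_measure n) (sphere_measure n) ((*\<^sub>v) U) = sphere_measure n"
proof -
  let ?L = "lborel_vec n"
  let ?R = "restrict_space ?L (punctured_ball n)"
  let ?S = "restrict_space ?L (unit_sphere n)"
  let ?N = "uniform_measure ?R (punctured_ball n)"
  let ?f = "\<lambda>x :: real Matrix.vec. (1 / vnorm x) \<cdot>\<^sub>v x"
  have sub: "punctured_ball n \<subseteq> carrier_vec n" "unit_sphere n \<subseteq> carrier_vec n"
    by (auto simp: punctured_ball_def unit_ball_def unit_sphere_def)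
  have sets_R: "A \<in> sets ?R \<longleftrightarrow> A \<subseteq> punctured_ball n \<and> A \<in> sets ?L" for A
    using sets_punctured_ball sub by (intro sets_restrict_space_iff) (simp add: Int_absorb2)
  have PR: "punctured_ball n \<in> sets ?R"
    using sets_punctured_ball by (simp add: sets_R)
  have eR: "emeasure ?R A = emeasure ?L A" if "A \<subseteq> punctured_ball n" for A
    using sets_punctured_ball sub that by (intro emeasure_restrict_space) (simp_all add: Int_absorb2)
  have pos: "emeasure ?R (punctured_ball n) \<noteq> 0" "emeasure ?R (punctured_ball n) \<noteq> \<infinity>"
    using emeasure_unit_ball_pos[of n] emeasure_unit_ball_finite[of n] emeasure_punctured_ball[OF n]
    by (auto simp: eR)
  interpret N: prob_space ?N
    using pos by (rule prob_space_uniform_measure)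
  have f: "?f \<in> ?N \<rightarrow>\<^sub>M ?S"
    using normalize_measurable by simp
  show "prob_space (sphere_measure n)"
    unfolding sphere_measure_def using f by (rule N.prob_space_distr)
  show "space (sphere_measure n) = unit_sphere n"
    using sub by (auto simp: sphere_measure_def space_restrict_space)
  show "sets (sphere_measure n) = sets ?S"
    by (simp add: sphere_measure_def)
  assume U: "rotation n U"
  have UC: "U \<in> carrier_mat n n"
    using U by (auto simp: rotation_def)
  have mU: "(*\<^sub>v) U \<in> ?L \<rightarrow>\<^sub>M ?L"
    using measurable_mult_mat_vec[OF UC measurable_ident_sets[OF refl]] by simp
  have UP: "U *\<^sub>v x \<in> punctured_ball n \<longleftrightarrow> x \<in> punctured_ball n" if "x \<in> carrier_vec n" for x
    using that UC vnorm_rotation[OF U that] vnorm_eq_0_iff[of x n] vnorm_eq_0_iff[of "U *\<^sub>v x" n]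
    by (auto simp: punctured_ball_def unit_ball_def)
  have mUR: "(*\<^sub>v) U \<in> ?R \<rightarrow>\<^sub>M ?R"
    using mU sub UP by (intro measurable_restrict_space3) auto
  then have mUN: "(*\<^sub>v) U \<in> ?N \<rightarrow>\<^sub>M ?N"
    by simp
  have mUS: "(*\<^sub>v) U \<in> ?S \<rightarrow>\<^sub>M ?S"
    using mU sub UC vnorm_rotation[OF U] by (intro measurable_restrict_space3) (auto simp: unit_sphere_def)
  have rot: "distr ?N ?N ((*\<^sub>v) U) = ?N"
  proof (rule measure_eqI)
    fix A assume "A \<in> sets (distr ?N ?N ((*\<^sub>v) U))"
    then have A: "A \<in> sets ?R" by simp
    then have AP: "A \<subseteq> punctured_ball n" and AL: "A \<in> sets ?L"
      by (auto simp: sets_R)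
    let ?A = "(*\<^sub>v) U -` A \<inter> space ?R"
    have eq: "?A = (*\<^sub>v) U -` A \<inter> carrier_vec n"
      using AP UP sub by (auto simp: space_restrict_space)
    have A': "?A \<in> sets ?R" "?A \<subseteq> punctured_ball n"
      using measurable_sets[OF mUR A] by (auto simp: space_restrict_space)
    have "emeasure (distr ?N ?N ((*\<^sub>v) U)) A = emeasure ?N ?A"
      using A emeasure_distr[OF mUN, of A] by simp
    also have "\<dots> = emeasure ?L ?A / emeasure ?R (punctured_ball n)"
      using A' PR by (simp add: emeasure_uniform_measure eR Int_absorb1)
    also have "emeasure ?L ?A = emeasure ?L A"
      unfolding eq by (rule emeasure_lborel_vec_rotation[OF U AL])
    also have "emeasure ?L A / emeasure ?R (punctured_ball n) = emeasure ?N A"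
      using A AP PR by (simp add: emeasure_uniform_measure eR Int_absorb1)
    finally show "emeasure (distr ?N ?N ((*\<^sub>v) U)) A = emeasure ?N A" .
  qed simp
  have "distr (sphere_measure n) (sphere_measure n) ((*\<^sub>v) U) = distr (distr ?N ?S ?f) ?S ((*\<^sub>v) U)"
    unfolding sphere_measure_def by (rule distr_cong) simp_all
  also have "\<dots> = distr ?N ?S ((*\<^sub>v) U \<circ> ?f)"
    using mUS f by (rule distr_distr)
  also have "\<dots> = distr ?N ?S (?f \<circ> (*\<^sub>v) U)"
    using sub UC vnorm_rotation[OF U]
    by (intro distr_cong) (auto simp: space_restrict_space mult_mat_vec subset_iff)
  also have "\<dots> = distr (distr ?N ?N ((*\<^sub>v) U)) ?S ?f"
    using f mUN by (rule distr_distr[symmetric])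
  also have "\<dots> = sphere_measure n"
    unfolding rot by (simp add: sphere_measure_def)
  finally show "distr (sphere_measure n) (sphere_measure n) ((*\<^sub>v) U) = sphere_measure n" .
qed

end

theory Submission
  imports Defs
begin

text \<open>
  Let \<open>G\<close> be the Gram matrix of the vectors \<open>T e\<^sub>i\<close>, where \<open>E = T\<inverse>(D\<^sub>n)\<close>; rotation invariance gives
  \<open>tr G = n M\<^sub>E\<^sup>2\<close>. The inclusion for \<open>\<sigma>\<close> means that the Schur complement of \<open>G\<close> with respect to the
  complementary set \<open>S\<close> is bounded above by a multiple of the identity. Schur complements commute with
  \<open>G \<mapsto> R\<^sub>s = G (1 - s G)\<inverse>\<close>. The flow \<open>R' = R\<^sup>2\<close> raises \<open>tr R\<close> at rate \<open>tr R\<^sup>2\<close>, while pivoting on a suitable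
  diagonal entry lowers it by at least \<open>tr R\<^sup>2 / tr R\<close>. So every pivot pays for an increase of \<open>s\<close> by a
  fixed multiple of \<open>1 / tr G\<close>, and after \<open>k\<close> pivots the Schur complement is at most \<open>1 / s = 4 tr G / k\<close>.
  With \<open>k\<close> about \<open>\<theta> n\<close> this gives the inclusion even without the logarithm.

  Inverses and spectra are avoided by expressing the relation between \<open>G\<close>, \<open>S\<close> and \<open>R\<close> variationally:
  for all \<open>x\<close>, \<open>y\<close> some \<open>z\<close> supported on \<open>S\<close> satisfies
  \<open>\<langle>G(x + s y + z), x + s y + z\<rangle> \<le> \<langle>R x, x\<rangle> + s |y|\<^sup>2\<close>; at the end one takes \<open>x = 0\<close>.
\<close>

subsection \<open>Positive semidefinite forms\<close>

text \<open>Matrices and vectors are plain functions of which only the entries below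
  \<open>n\<close> enter, so sums such as \<open>x + s y + z\<close> carry no dimension
  conditions.\<close>

definition bilin :: "nat \<Rightarrow> (nat \<Rightarrow> nat \<Rightarrow> real) \<Rightarrow> (nat \<Rightarrow> real) \<Rightarrow> (nat \<Rightarrow> real) \<Rightarrow> real" where
  "bilin n R x y = (\<Sum>i<n. \<Sum>j<n. R i j * x i * y j)"

text \<open>Symmetry is demanded at all indices, which lets \<open>psd_sym\<close> rewrite without
  bounds; \<open>flow\<close>, \<open>pivot\<close> and \<open>gram\<close> keep it there.\<close>

definition psd :: "nat \<Rightarrow> (nat \<Rightarrow> nat \<Rightarrow> real) \<Rightarrow> bool" where
  "psd n R \<longleftrightarrow> (\<forall>i j. R i j = R j i) \<and> (\<forall>x. 0 \<le> bilin n R x x)"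

definition trace_sum :: "nat \<Rightarrow> (nat \<Rightarrow> nat \<Rightarrow> real) \<Rightarrow> real" where
  "trace_sum n R = (\<Sum>i<n. R i i)"

text \<open>For symmetric \<open>R\<close> this is the trace of \<open>R^2\<close>, the speed at
  which the flow \<open>R' = R^2\<close> raises the trace.\<close>

definition frobenius_sq :: "nat \<Rightarrow> (nat \<Rightarrow> nat \<Rightarrow> real) \<Rightarrow> real" where
  "frobenius_sq n R = (\<Sum>i<n. \<Sum>j<n. (R i j)\<^sup>2)"

lemma psd_sym: "psd n R \<Longrightarrow> R i j = R j i"
  and psd_nonneg: "psd n R \<Longrightarrow> 0 \<le> bilin n R x x"
  by (auto simp: psd_def)

lemma bilin_commute: "psd n R \<Longrightarrow> bilin n R x y = bilin n R y x"
  unfolding bilin_def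
  by (subst sum.swap) (auto intro!: sum.cong simp: psd_sym[of n R])

lemma bilin_square_add:
  assumes "psd n R"
  shows "bilin n R (\<lambda>i. x i + t * y i) (\<lambda>i. x i + t * y i) =
    bilin n R x x + 2 * t * bilin n R x y + t\<^sup>2 * bilin n R y y"
proof -
  have "bilin n R (\<lambda>i. x i + t * y i) (\<lambda>i. x i + t * y i) =
      bilin n R x x + t * bilin n R x y + t * bilin n R y x + t\<^sup>2 * bilin n R y y"
    by (simp add: bilin_def algebra_simps sum.distrib sum_distrib_left power2_eq_square)
  then show ?thesis
    using bilin_commute[OF assms, of y x] by simp
qed

lemma bilin_unit:
  assumes "j < n"
  shows "bilin n R x (\<lambda>i. if i = j then 1 else 0) = (\<Sum>i<n. R i j * x i)"
proof -
  have "(\<Sum>k<n. R i k * x i * (if k = j then 1 else 0)) = R i j * x i" for i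
    using assms by (subst sum.remove[of _ j]) (auto intro!: sum.neutral)
  then show ?thesis by (simp add: bilin_def)
qed

lemma bilin_unit_unit:
  assumes "i < n" "j < n"
  shows "bilin n R (\<lambda>k. if k = i then 1 else 0) (\<lambda>k. if k = j then 1 else 0) = R i j"
  using assms(1) unfolding bilin_unit[OF assms(2)]
  by (subst sum.remove[of _ i]) (auto intro!: sum.neutral)

lemma psd_diag_nonneg: "psd n R \<Longrightarrow> i < n \<Longrightarrow> 0 \<le> R i i"
  using psd_nonneg bilin_unit_unit[of i n i R] by metis

lemma psd_trace_nonneg: "psd n R \<Longrightarrow> 0 \<le> trace_sum n R"
  unfolding trace_sum_def by (intro sum_nonneg) (auto intro: psd_diag_nonneg)

lemma bilin_Cauchy_Schwarz:
  assumes "psd n R"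
  shows "(bilin n R x y)\<^sup>2 \<le> bilin n R x x * bilin n R y y"
proof -
  let ?a = "bilin n R x x" and ?b = "bilin n R x y" and ?c = "bilin n R y y"
  have nn: "0 \<le> ?a + 2 * t * ?b + t\<^sup>2 * ?c" for t
    unfolding bilin_square_add[OF assms, symmetric] by (rule psd_nonneg[OF assms])
  show ?thesis
  proof (cases "?c = 0")
    case True
    have "?b = 0"
    proof (rule ccontr)
      assume "?b \<noteq> 0"
      \<comment> \<open>With \<open>?c = 0\<close> the nonnegative quadratic in \<open>t\<close> is
        affine; this \<open>t\<close> would give it the value -1.\<close>
      then have "2 * (- (?a + 1) / (2 * ?b)) * ?b = - (?a + 1)"
        by simp
      with nn[of "- (?a + 1) / (2 * ?b)"] True show False
        by simp
    qed
    then show ?thesis using True by simp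
  next
    case False
    then have c: "?c > 0" using psd_nonneg[OF assms, of y] by simp
    have "0 \<le> ?c * (?a + 2 * (- ?b / ?c) * ?b + (- ?b / ?c)\<^sup>2 * ?c)"
      using nn[of "- ?b / ?c"] c by (intro mult_nonneg_nonneg) auto
    also have "\<dots> = ?a * ?c - ?b\<^sup>2"
      using c by (simp add: field_simps power2_eq_square)
    finally show ?thesis by simp
  qed
qed

lemma psd_entry_sq_le: "psd n R \<Longrightarrow> i < n \<Longrightarrow> j < n \<Longrightarrow> (R i j)\<^sup>2 \<le> R i i * R j j"
  using bilin_Cauchy_Schwarz[of n R "\<lambda>k. if k = i then 1 else 0" "\<lambda>k. if k = j then 1 else 0"]
  by (simp add: bilin_unit_unit)

lemma frobenius_sq_le:
  assumes "psd n R"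
  shows "frobenius_sq n R \<le> (trace_sum n R)\<^sup>2"
proof -
  have "frobenius_sq n R \<le> (\<Sum>i<n. \<Sum>j<n. R i i * R j j)"
    unfolding frobenius_sq_def using psd_entry_sq_le[OF assms] by (intro sum_mono) auto
  also have "\<dots> = (trace_sum n R)\<^sup>2"
    by (simp add: trace_sum_def power2_eq_square sum_product)
  finally show ?thesis .
qed

text \<open>Replaces the bound of the largest eigenvalue by the trace: each entry is at most the
  geometric mean of two diagonal entries in absolute value, and the inequality between geometric and
  arithmetic mean separates the indices.\<close>

lemma bilin_le_trace:
  assumes "psd n R"
  shows "bilin n R y y \<le> trace_sum n R * (\<Sum>i<n. (y i)\<^sup>2)"
proof -
  let ?Y = "\<Sum>i<n. (y i)\<^sup>2"
  have "bilin n R y y \<le> (\<Sum>i<n. \<Sum>j<n. (R i i * (y j)\<^sup>2 + R j j * (y i)\<^sup>2) / 2)"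
    unfolding bilin_def
  proof (intro sum_mono)
    fix i j assume "i \<in> {..<n}" "j \<in> {..<n}"
    then have ij: "i < n" "j < n" by auto
    let ?p = "sqrt (R i i)" and ?q = "sqrt (R j j)"
    have pq: "?p\<^sup>2 = R i i" "?q\<^sup>2 = R j j"
      using psd_diag_nonneg[OF assms] ij by auto
    have "\<bar>R i j\<bar> \<le> ?p * ?q"
      using real_sqrt_le_mono[OF psd_entry_sq_le[OF assms ij]] by (simp add: real_sqrt_mult)
    then have "\<bar>R i j\<bar> * \<bar>y i * y j\<bar> \<le> ?p * ?q * \<bar>y i * y j\<bar>"
      by (rule mult_right_mono) simp
    moreover have "R i j * y i * y j \<le> \<bar>R i j\<bar> * \<bar>y i * y j\<bar>"
      by (metis abs_ge_self abs_mult mult.assoc)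
    moreover have "2 * (?p * \<bar>y j\<bar>) * (?q * \<bar>y i\<bar>) \<le> (?p * \<bar>y j\<bar>)\<^sup>2 + (?q * \<bar>y i\<bar>)\<^sup>2"
      by (rule sum_squares_bound)
    ultimately show "R i j * y i * y j \<le> (R i i * (y j)\<^sup>2 + R j j * (y i)\<^sup>2) / 2"
      by (simp add: power_mult_distrib pq abs_mult algebra_simps)
  qed
  also have "\<dots> = ((\<Sum>i<n. \<Sum>j<n. R i i * (y j)\<^sup>2) + (\<Sum>i<n. \<Sum>j<n. R j j * (y i)\<^sup>2)) / 2"
    by (simp add: sum.distrib sum_divide_distrib[symmetric])
  also have "\<dots> = trace_sum n R * ?Y"
  proof -
    have "(\<Sum>i<n. \<Sum>j<n. R j j * (y i)\<^sup>2) = (\<Sum>i<n. \<Sum>j<n. R i i * (y j)\<^sup>2)"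
      by (rule sum.swap)
    then show ?thesis by (simp add: trace_sum_def sum_product)
  qed
  finally show ?thesis .
qed

subsection \<open>Flow and pivot\<close>

text \<open>
  Replacing the exact flow \<open>R (1 - d R)\<inverse>\<close> by \<open>R + 2 d R\<^sup>2\<close> preserves the variational
  inequality as long as \<open>d R \<le> 1/2\<close>.
\<close>

definition flow :: "nat \<Rightarrow> real \<Rightarrow> (nat \<Rightarrow> nat \<Rightarrow> real) \<Rightarrow> nat \<Rightarrow> nat \<Rightarrow> real" where
  "flow n d R i j = R i j + 2 * d * (\<Sum>k<n. R i k * R k j)"

lemma bilin_eq_sum_act: "psd n R \<Longrightarrow> bilin n R x y = (\<Sum>k<n. (\<Sum>i<n. R i k * x i) * y k)"
  unfolding bilin_def by (subst sum.swap) (simp add: sum_distrib_right)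

lemma bilin_flow:
  assumes "psd n R"
  shows "bilin n (flow n d R) x x = bilin n R x x + 2 * d * (\<Sum>k<n. (\<Sum>i<n. R i k * x i)\<^sup>2)"
proof -
  have "(\<Sum>k<n. (\<Sum>i<n. R i k * x i)\<^sup>2) = (\<Sum>k<n. \<Sum>i<n. \<Sum>j<n. (R i k * x i) * (R j k * x j))"
    by (simp add: power2_eq_square sum_product)
  also have "\<dots> = (\<Sum>i<n. \<Sum>k<n. \<Sum>j<n. (R i k * x i) * (R j k * x j))"
    by (rule sum.swap)
  also have "\<dots> = (\<Sum>i<n. \<Sum>j<n. \<Sum>k<n. (R i k * x i) * (R j k * x j))"
    by (intro sum.cong refl sum.swap)
  also have "\<dots> = (\<Sum>i<n. \<Sum>j<n. (\<Sum>k<n. R i k * R j k) * x i * x j)"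
    by (simp add: sum_distrib_left sum_distrib_right mult_ac)
  also have "\<dots> = (\<Sum>i<n. \<Sum>j<n. (\<Sum>k<n. R i k * R k j) * x i * x j)"
    by (intro sum.cong refl arg_cong2[where f = "(*)"] psd_sym[OF assms])
  finally have *: "(\<Sum>k<n. (\<Sum>i<n. R i k * x i)\<^sup>2) =
      (\<Sum>i<n. \<Sum>j<n. (\<Sum>k<n. R i k * R k j) * x i * x j)" .
  show ?thesis
    unfolding * by (simp add: bilin_def flow_def algebra_simps sum.distrib sum_distrib_left)
qed

lemma psd_flow:
  assumes "psd n R" "0 \<le> d"
  shows "psd n (flow n d R)"
  unfolding psd_def
proof (intro conjI allI)
  show "flow n d R i j = flow n d R j i" for i j
    by (simp add: flow_def psd_sym[OF assms(1)] mult.commute)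
  show "0 \<le> bilin n (flow n d R) x x" for x
    unfolding bilin_flow[OF assms(1)]
    using psd_nonneg[OF assms(1)] assms(2) by (intro add_nonneg_nonneg mult_nonneg_nonneg sum_nonneg) auto
qed

lemma trace_flow:
  assumes "psd n R"
  shows "trace_sum n (flow n d R) = trace_sum n R + 2 * d * frobenius_sq n R"
  by (simp add: trace_sum_def flow_def frobenius_sq_def sum.distrib sum_distrib_left
      power2_eq_square psd_sym[OF assms])

text \<open>Expanding the squares, the cross term is \<open>4 d\<close> times the trace of
  \<open>R^3\<close>, which is the sum of the values of the form at the rows of \<open>R\<close> and
  hence nonnegative.\<close>

lemma frobenius_flow_ge:
  assumes "psd n R" "0 \<le> d"
  shows "frobenius_sq n R \<le> frobenius_sq n (flow n d R)"
proof -
  let ?P = "\<lambda>i j. \<Sum>k<n. R i k * R k j"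
  have "(\<Sum>j<n. R i j * ?P i j) = bilin n R (R i) (R i)" for i
  proof -
    have "bilin n R (R i) (R i) = (\<Sum>j<n. \<Sum>k<n. R k j * R i k * R i j)"
      unfolding bilin_def by (rule sum.swap)
    then show ?thesis
      by (simp add: sum_distrib_left mult_ac)
  qed
  then have "0 \<le> (\<Sum>i<n. \<Sum>j<n. R i j * ?P i j)"
    using psd_nonneg[OF assms(1)] by (simp add: sum_nonneg)
  then have "frobenius_sq n R \<le> frobenius_sq n R + 4 * d * (\<Sum>i<n. \<Sum>j<n. R i j * ?P i j)"
    using assms(2) by simp
  also have "\<dots> = (\<Sum>i<n. \<Sum>j<n. (R i j)\<^sup>2 + 4 * d * (R i j * ?P i j))"
    by (simp add: frobenius_sq_def sum.distrib sum_distrib_left)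
  also have "\<dots> \<le> (\<Sum>i<n. \<Sum>j<n. (flow n d R i j)\<^sup>2)"
  proof (intro sum_mono)
    fix i j
    have "(flow n d R i j)\<^sup>2 = (R i j)\<^sup>2 + 4 * d * (R i j * ?P i j) + (2 * d * ?P i j)\<^sup>2"
      unfolding flow_def by (simp add: power2_sum)
    then show "(R i j)\<^sup>2 + 4 * d * (R i j * ?P i j) \<le> (flow n d R i j)\<^sup>2" by simp
  qed
  finally show ?thesis by (simp add: frobenius_sq_def)
qed

text \<open>The budget \<open>d |y|^2\<close> is spent in two halves. The mixed term
  \<open>2 d <R x, y>\<close> is at most \<open>2 d |R x|^2\<close>, which is what the flow adds,
  plus one half; \<open>d^2 <R y, y>\<close> is at most the other half because \<open>d R\<close> is
  at most 1/2.\<close>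

lemma bilin_shift_le_flow:
  assumes R: "psd n R" and d: "0 \<le> d" "d * trace_sum n R \<le> 1 / 2"
  shows "bilin n R (\<lambda>i. x i + d * y i) (\<lambda>i. x i + d * y i) \<le>
    bilin n (flow n d R) x x + d * (\<Sum>i<n. (y i)\<^sup>2)"
proof -
  let ?a = "\<lambda>k. \<Sum>i<n. R i k * x i" and ?Y = "\<Sum>i<n. (y i)\<^sup>2"
  have "2 * bilin n R x y = (\<Sum>k<n. 2 * (?a k * y k))"
    by (simp add: bilin_eq_sum_act[OF R] sum_distrib_left)
  also have "\<dots> \<le> (\<Sum>k<n. 2 * (?a k)\<^sup>2 + (y k)\<^sup>2 / 2)"
  proof (rule sum_mono)
    have "2 * (a * b) \<le> 2 * a\<^sup>2 + b\<^sup>2 / 2" for a b :: real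
      using zero_le_power2[of "2 * a - b"] by (simp add: power2_eq_square algebra_simps)
    then show "2 * (?a k * y k) \<le> 2 * (?a k)\<^sup>2 + (y k)\<^sup>2 / 2" for k .
  qed
  also have "\<dots> = 2 * (\<Sum>k<n. (?a k)\<^sup>2) + ?Y / 2"
    by (simp add: sum.distrib sum_distrib_left sum_divide_distrib)
  finally have 1: "d * (2 * bilin n R x y) \<le> d * (2 * (\<Sum>k<n. (?a k)\<^sup>2) + ?Y / 2)"
    using d(1) by (rule mult_left_mono)
  have "d * bilin n R y y \<le> d * (trace_sum n R * ?Y)"
    using bilin_le_trace[OF R] d(1) by (rule mult_left_mono)
  also have "\<dots> \<le> 1 / 2 * ?Y"
    unfolding mult.assoc[symmetric] using d(2) by (intro mult_right_mono sum_nonneg) auto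
  finally have 2: "d * (d * bilin n R y y) \<le> d * (1 / 2 * ?Y)"
    using d(1) by (rule mult_left_mono)
  have "A + 2 * d * b + d\<^sup>2 * c \<le> A + 2 * d * s + d * Y"
    if "d * (2 * b) \<le> d * (2 * s + Y / 2)" "d * (d * c) \<le> d * (1 / 2 * Y)" for A b c s Y :: real
    using that by (simp add: algebra_simps power2_eq_square)
  from this[OF 1 2] show ?thesis
    unfolding bilin_square_add[OF R] bilin_flow[OF R] .
qed

text \<open>The Schur complement of the entry \<open>R j j\<close>, with the vanishing row and column kept.\<close>

definition pivot :: "nat \<Rightarrow> (nat \<Rightarrow> nat \<Rightarrow> real) \<Rightarrow> nat \<Rightarrow> nat \<Rightarrow> real" where
  "pivot j R a b = R a b - R a j * R b j / R j j"

text \<open>Completing the square in coordinate \<open>j\<close>: the value of the Schur complement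
  at \<open>x\<close> is attained by the old form at a point of the line through \<open>x\<close> in
  direction \<open>j\<close>. Eliminating \<open>j\<close> thus amounts to granting a free shift
  along it.\<close>

lemma bilin_pivot:
  assumes R: "psd n R" and j: "j < n" "0 < R j j"
  obtains t where
    "bilin n (pivot j R) x x =
      bilin n R (\<lambda>i. x i + t * (if i = j then 1 else 0)) (\<lambda>i. x i + t * (if i = j then 1 else 0))"
proof
  let ?u = "\<lambda>i. if i = j then 1 else 0 :: real"
  let ?b = "\<Sum>i<n. R i j * x i"
  have "bilin n (pivot j R) x x = bilin n R x x - ?b\<^sup>2 / R j j"
    by (simp add: bilin_def pivot_def power2_eq_square sum_product algebra_simps sum_subtractf
        sum_divide_distrib)
  also have "\<dots> = bilin n R x x + 2 * (- ?b / R j j) * ?b + (- ?b / R j j)\<^sup>2 * R j j"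
    using j(2) by (simp add: field_simps power2_eq_square)
  finally show "bilin n (pivot j R) x x =
      bilin n R (\<lambda>i. x i + (- ?b / R j j) * ?u i) (\<lambda>i. x i + (- ?b / R j j) * ?u i)"
    unfolding bilin_square_add[OF R] bilin_unit_unit[OF j(1) j(1)] bilin_unit[OF j(1)] .
qed

lemma psd_pivot:
  assumes R: "psd n R" and j: "j < n" "0 < R j j"
  shows "psd n (pivot j R)"
  unfolding psd_def
proof (intro conjI allI)
  show "pivot j R a b = pivot j R b a" for a b
    by (simp add: pivot_def psd_sym[OF R, of a b] mult.commute)
  show "0 \<le> bilin n (pivot j R) x x" for x
    by (rule bilin_pivot[OF R j, of x]) (simp add: psd_nonneg[OF R])
qed

lemma trace_pivot: "trace_sum n (pivot j R) = trace_sum n R - (\<Sum>i<n. (R i j)\<^sup>2) / R j j"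
  by (simp add: trace_sum_def pivot_def sum_subtractf sum_divide_distrib power2_eq_square)

text \<open>Averaging with weights \<open>R j j\<close>: the squared column norms sum to
  \<open>?F\<close> and the weights to \<open>?T\<close>, so some ratio \<open>?f j / R j j\<close>
  reaches \<open>?F / ?T\<close>. By \<open>trace_pivot\<close> this ratio is the loss of trace.
  Columns over a zero diagonal entry vanish and contribute nothing.\<close>

lemma exists_good_pivot:
  assumes R: "psd n R" and tr: "0 < trace_sum n R"
  obtains j where "j < n" "0 < R j j"
    "trace_sum n (pivot j R) \<le> trace_sum n R - frobenius_sq n R / trace_sum n R"
proof -
  let ?T = "trace_sum n R" and ?F = "frobenius_sq n R" and ?f = "\<lambda>j. \<Sum>i<n. (R i j)\<^sup>2"
  have F: "(\<Sum>j<n. ?f j) = ?F"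
    unfolding frobenius_sq_def by (rule sum.swap)
  have zero: "?f j = 0" if "j < n" "\<not> 0 < R j j" for j
  proof -
    have "R j j = 0" using psd_diag_nonneg[OF R that(1)] that(2) by simp
    then show ?thesis
      using psd_entry_sq_le[OF R _ that(1)] by (intro sum.neutral) auto
  qed
  have "\<exists>j<n. 0 < R j j \<and> R j j * ?F \<le> ?f j * ?T"
  proof (rule ccontr)
    assume none: "\<not> ?thesis"
    \<comment> \<open>A positive diagonal entry is what makes the summed inequality strict.\<close>
    obtain m where m: "m < n" "0 < R m m"
    proof (rule ccontr)
      assume "\<not> thesis"
      then have "\<not> 0 < R m m" if "m < n" for m using that \<open>\<And>m. m < n \<Longrightarrow> 0 < R m m \<Longrightarrow> thesis\<close> by blast
      then have "?T \<le> 0" unfolding trace_sum_def by (intro sum_nonpos) (auto simp: not_less)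
      then show False using tr by simp
    qed
    have "(\<Sum>j<n. ?f j * ?T) < (\<Sum>j<n. R j j * ?F)"
    proof (rule sum_strict_mono_ex1)
      show "\<forall>j\<in>{..<n}. ?f j * ?T \<le> R j j * ?F"
      proof
        fix j assume "j \<in> {..<n}"
        then have "j < n" by simp
        show "?f j * ?T \<le> R j j * ?F"
        proof (cases "0 < R j j")
          case True
          then show ?thesis using none \<open>j < n\<close> by (meson le_cases)
        next
          case False
          then show ?thesis
            using zero[OF \<open>j < n\<close> False] psd_diag_nonneg[OF R \<open>j < n\<close>] by (simp add: frobenius_sq_def)
        qed
      qed
      show "\<exists>j\<in>{..<n}. ?f j * ?T < R j j * ?F"
        using none m by (auto simp: not_le)
    qed simp
    moreover have "(\<Sum>j<n. ?f j * ?T) = ?F * ?T" "(\<Sum>j<n. R j j * ?F) = ?T * ?F"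
      by (simp_all add: sum_distrib_right[symmetric] F trace_sum_def)
    ultimately show False by simp
  qed
  then obtain j where j: "j < n" "0 < R j j" "R j j * ?F \<le> ?f j * ?T" by blast
  show ?thesis
  proof (rule that[OF j(1,2)])
    show "trace_sum n (pivot j R) \<le> ?T - ?F / ?T"
      unfolding trace_pivot using j(2,3) tr by (simp add: field_simps)
  qed
qed

text \<open>The step length depends on the fixed bound \<open>h\<close> and not on the current
  trace, so that all steps are equal. The flow raises the trace by \<open>?F / (2 h)\<close>, and
  the pivot takes at least this much away again. The vector \<open>z\<close> is the free shift along
  the pivoted coordinate.\<close>

lemma flow_pivot_step:
  assumes R: "psd n R" and h: "0 < h" "trace_sum n R \<le> h"
  obtains R' J where "psd n R'" "trace_sum n R' \<le> h" "J \<subseteq> {..<n}" "card J \<le> 1"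
    "\<And>x y. \<exists>z. (\<forall>i. i \<notin> J \<longrightarrow> z i = 0) \<and>
      bilin n R (\<lambda>i. x i + 1 / (4 * h) * y i + z i) (\<lambda>i. x i + 1 / (4 * h) * y i + z i) \<le>
      bilin n R' x x + 1 / (4 * h) * (\<Sum>i<n. (y i)\<^sup>2)"
proof -
  define d where "d = 1 / (4 * h)"
  define Q where "Q = flow n d R"
  let ?T = "trace_sum n R" and ?F = "frobenius_sq n R"
  have d: "0 \<le> d" "d * ?T \<le> 1 / 2"
    using h by (auto simp: d_def field_simps)
  have Q: "psd n Q" unfolding Q_def by (rule psd_flow[OF R d(1)])
  have move: "bilin n R (\<lambda>i. x i + d * y i) (\<lambda>i. x i + d * y i) \<le> bilin n Q x x + d * (\<Sum>i<n. (y i)\<^sup>2)"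
    for x y unfolding Q_def by (rule bilin_shift_le_flow[OF R d])
  have TQ: "trace_sum n Q = ?T + ?F / (2 * h)"
    by (simp add: Q_def trace_flow[OF R] d_def)
  have F0: "0 \<le> ?F" by (simp add: frobenius_sq_def sum_nonneg)
  show ?thesis
  proof (cases "trace_sum n Q > 0")
    \<comment> \<open>Without a positive trace after the flow no pivot is made, and \<open>J\<close>
      is empty.\<close>
    case False
    show ?thesis
    proof (rule that[OF Q, of "{}"])
      show "\<exists>z. (\<forall>i. i \<notin> {} \<longrightarrow> z i = 0) \<and>
          bilin n R (\<lambda>i. x i + 1 / (4 * h) * y i + z i) (\<lambda>i. x i + 1 / (4 * h) * y i + z i) \<le>
          bilin n Q x x + 1 / (4 * h) * (\<Sum>i<n. (y i)\<^sup>2)" for x y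
        using move[of x y] by (intro exI[of _ "\<lambda>_. 0"]) (simp add: d_def)
    qed (use False h in auto)
  next
    case True
    obtain j where j: "j < n" "0 < Q j j"
      "trace_sum n (pivot j Q) \<le> trace_sum n Q - frobenius_sq n Q / trace_sum n Q"
      by (rule exists_good_pivot[OF Q True])
    have "?F \<le> h\<^sup>2"
      using frobenius_sq_le[OF R] power_mono[OF h(2) psd_trace_nonneg[OF R], of 2] by linarith
    then have "trace_sum n Q \<le> 2 * h"
    proof -
      assume "?F \<le> h\<^sup>2"
      then have "?F / (2 * h) \<le> h\<^sup>2 / (2 * h)"
        using h(1) by (intro divide_right_mono) auto
      also have "\<dots> \<le> h"
        using h(1) by (simp add: power2_eq_square)
      finally show ?thesis
        using h(2) TQ by linarith
    qed
    \<comment> \<open>The pivot is chosen for \<open>Q\<close>, but its gain dominates the rise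
      computed from \<open>R\<close>: the trace of \<open>Q\<close> is at most \<open>2 h\<close>
      and its Frobenius norm is no smaller than that of \<open>R\<close>.\<close>
    then have "?F / (2 * h) \<le> ?F / trace_sum n Q"
      using F0 True by (intro divide_left_mono) auto
    also have "\<dots> \<le> frobenius_sq n Q / trace_sum n Q"
      unfolding Q_def using frobenius_flow_ge[OF R d(1)] True
      by (intro divide_right_mono) (auto simp: Q_def)
    finally have tr: "trace_sum n (pivot j Q) \<le> h"
      using j(3) h(2) TQ by linarith
    show ?thesis
    proof (rule that[OF psd_pivot[OF Q j(1,2)] tr, of "{j}"])
      fix x y
      obtain t where t: "bilin n (pivot j Q) x x =
          bilin n Q (\<lambda>i. x i + t * (if i = j then 1 else 0)) (\<lambda>i. x i + t * (if i = j then 1 else 0))"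
        by (rule bilin_pivot[OF Q j(1,2)])
      show "\<exists>z. (\<forall>i. i \<notin> {j} \<longrightarrow> z i = 0) \<and>
          bilin n R (\<lambda>i. x i + 1 / (4 * h) * y i + z i) (\<lambda>i. x i + 1 / (4 * h) * y i + z i) \<le>
          bilin n (pivot j Q) x x + 1 / (4 * h) * (\<Sum>i<n. (y i)\<^sup>2)"
        using move[of "\<lambda>i. x i + t * (if i = j then 1 else 0)" y]
        unfolding t d_def
        by (intro exI[of _ "\<lambda>i. t * (if i = j then 1 else 0)"]) (simp add: algebra_simps)
    qed (use j in auto)
  qed
qed

section \<open>Iterating the step and choosing the coordinates\<close>

text \<open>Keeping both \<open>x\<close> and \<open>y\<close> in the inequality makes it
  composable: with the same \<open>y\<close> throughout, the step lengths, the errors and the shifts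
  \<open>z\<close> simply add up.\<close>

lemma flow_pivot_iterate:
  assumes G: "psd n G" and h: "0 < h" "trace_sum n G \<le> h"
  shows "\<exists>S R. S \<subseteq> {..<n} \<and> card S \<le> k \<and> psd n R \<and> trace_sum n R \<le> h \<and>
    (\<forall>x y. \<exists>z. (\<forall>i. i \<notin> S \<longrightarrow> z i = 0) \<and>
      bilin n G (\<lambda>i. x i + real k / (4 * h) * y i + z i) (\<lambda>i. x i + real k / (4 * h) * y i + z i) \<le>
      bilin n R x x + real k / (4 * h) * (\<Sum>i<n. (y i)\<^sup>2))"
proof (induction k)
  case 0
  have "\<exists>z. (\<forall>i. i \<notin> {} \<longrightarrow> z i = 0) \<and>
      bilin n G (\<lambda>i. x i + real 0 / (4 * h) * y i + z i) (\<lambda>i. x i + real 0 / (4 * h) * y i + z i) \<le>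
      bilin n G x x + real 0 / (4 * h) * (\<Sum>i<n. (y i)\<^sup>2)" for x y :: "nat \<Rightarrow> real"
    by (rule exI[of _ "\<lambda>_. 0"]) simp
  then show ?case
    using G h(2) by (intro exI[of _ "{}"] exI[of _ G] conjI allI) simp_all
next
  case (Suc k)
  define s where "s = real k / (4 * h)"
  define d where "d = 1 / (4 * h)"
  have sd: "real (Suc k) / (4 * h) = s + d"
    by (simp add: s_def d_def add_divide_distrib)
  obtain S R where S: "S \<subseteq> {..<n}" "card S \<le> k" and R: "psd n R" "trace_sum n R \<le> h"
    and inv: "\<And>x y. \<exists>z. (\<forall>i. i \<notin> S \<longrightarrow> z i = 0) \<and>
      bilin n G (\<lambda>i. x i + s * y i + z i) (\<lambda>i. x i + s * y i + z i) \<le>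
      bilin n R x x + s * (\<Sum>i<n. (y i)\<^sup>2)"
    using Suc.IH unfolding s_def by blast
  obtain R' J where R': "psd n R'" "trace_sum n R' \<le> h" and J: "J \<subseteq> {..<n}" "card J \<le> 1"
    and step: "\<And>x y. \<exists>z. (\<forall>i. i \<notin> J \<longrightarrow> z i = 0) \<and>
      bilin n R (\<lambda>i. x i + d * y i + z i) (\<lambda>i. x i + d * y i + z i) \<le>
      bilin n R' x x + d * (\<Sum>i<n. (y i)\<^sup>2)"
    by (rule flow_pivot_step[OF R(1) h(1) R(2), folded d_def]) (rule that)
  have "card (S \<union> J) \<le> Suc k"
    using card_Un_le[of S J] S(2) J(2) by linarith
  moreover have "\<exists>z. (\<forall>i. i \<notin> S \<union> J \<longrightarrow> z i = 0) \<and>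
      bilin n G (\<lambda>i. x i + (s + d) * y i + z i) (\<lambda>i. x i + (s + d) * y i + z i) \<le>
      bilin n R' x x + (s + d) * (\<Sum>i<n. (y i)\<^sup>2)" for x y
  proof -
    obtain z where z: "\<forall>i. i \<notin> J \<longrightarrow> z i = 0"
      "bilin n R (\<lambda>i. x i + d * y i + z i) (\<lambda>i. x i + d * y i + z i) \<le>
        bilin n R' x x + d * (\<Sum>i<n. (y i)\<^sup>2)"
      using step by blast
    \<comment> \<open>The earlier inequality is applied at the point produced by the new step, so
      its right-hand side is the left-hand side of that step.\<close>
    obtain w where w: "\<forall>i. i \<notin> S \<longrightarrow> w i = 0"
      "bilin n G (\<lambda>i. (x i + d * y i + z i) + s * y i + w i) (\<lambda>i. (x i + d * y i + z i) + s * y i + w i) \<le>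
        bilin n R (\<lambda>i. x i + d * y i + z i) (\<lambda>i. x i + d * y i + z i) + s * (\<Sum>i<n. (y i)\<^sup>2)"
      using inv[of "\<lambda>i. x i + d * y i + z i" y] by blast
    have "(\<lambda>i. (x i + d * y i + z i) + s * y i + w i) = (\<lambda>i. x i + (s + d) * y i + (z i + w i))"
      by (simp add: algebra_simps)
    with z w show ?thesis
      by (intro exI[of _ "\<lambda>i. z i + w i"]) (simp add: algebra_simps)
  qed
  ultimately show ?case
    unfolding sd using S(1) J(1) R'
    by (intro exI[of _ "S \<union> J"] exI[of _ R'] conjI allI) (simp_all only: Un_subset_iff)
qed

text \<open>Minimising over \<open>z\<close> supported on \<open>S\<close> gives the Schur
  complement of \<open>G\<close>, so the conclusion bounds that complement by \<open>4 h / k\<close>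
  times the identity.\<close>

lemma schur_complement_selection:
  assumes G: "psd n G" and h: "0 < h" "trace_sum n G \<le> h" and k: "0 < k"
  obtains S where "S \<subseteq> {..<n}" "card S \<le> k"
    "\<And>y. \<exists>z. (\<forall>i. i \<notin> S \<longrightarrow> z i = 0) \<and>
      bilin n G (\<lambda>i. y i + z i) (\<lambda>i. y i + z i) \<le> 4 * h / real k * (\<Sum>i<n. (y i)\<^sup>2)"
proof -
  define s where "s = real k / (4 * h)"
  have s: "0 < s" using h k by (simp add: s_def)
  obtain S R where S: "S \<subseteq> {..<n}" "card S \<le> k"
    and inv: "\<And>x y. \<exists>z. (\<forall>i. i \<notin> S \<longrightarrow> z i = 0) \<and>
      bilin n G (\<lambda>i. x i + s * y i + z i) (\<lambda>i. x i + s * y i + z i) \<le>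
      bilin n R x x + s * (\<Sum>i<n. (y i)\<^sup>2)"
    using flow_pivot_iterate[OF G h, of k] unfolding s_def by blast
  show ?thesis
  proof (rule that[OF S])
    fix y :: "nat \<Rightarrow> real"
    \<comment> \<open>At \<open>x = 0\<close> the unknown matrix \<open>R\<close> drops out, and
      rescaling \<open>y\<close> by \<open>1 / s\<close> turns the error \<open>s |y|^2\<close> into
      \<open>|y|^2 / s\<close>.\<close>
    obtain z where z: "\<forall>i. i \<notin> S \<longrightarrow> z i = 0"
      "bilin n G (\<lambda>i. 0 + s * (1 / s * y i) + z i) (\<lambda>i. 0 + s * (1 / s * y i) + z i) \<le>
       bilin n R (\<lambda>_. 0) (\<lambda>_. 0) + s * (\<Sum>i<n. (1 / s * y i)\<^sup>2)"
      using inv[of "\<lambda>_. 0" "\<lambda>i. 1 / s * y i"] by blast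
    have "s * (\<Sum>i<n. (1 / s * y i)\<^sup>2) = 1 / s * (\<Sum>i<n. (y i)\<^sup>2)"
      using s by (simp add: sum_distrib_left power2_eq_square)
    moreover have "1 / s = 4 * h / real k" by (simp add: s_def)
    moreover have "(\<lambda>i. 0 + s * (1 / s * y i) + z i) = (\<lambda>i. y i + z i)"
      using s by simp
    moreover have "bilin n R (\<lambda>_. 0) (\<lambda>_. 0) = 0"
      by (simp add: bilin_def)
    ultimately have "bilin n G (\<lambda>i. y i + z i) (\<lambda>i. y i + z i) \<le> 4 * h / real k * (\<Sum>i<n. (y i)\<^sup>2)"
      using z(2) by (simp only: add_0)
    with z(1) show "\<exists>z. (\<forall>i. i \<notin> S \<longrightarrow> z i = 0) \<and>
        bilin n G (\<lambda>i. y i + z i) (\<lambda>i. y i + z i) \<le> 4 * h / real k * (\<Sum>i<n. (y i)\<^sup>2)"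
      by blast
  qed
qed


lemma proportional_selection:
  assumes G: "psd n G" and \<theta>: "0 < \<theta>" and n: "0 < n"
  obtains S where "S \<subseteq> {..<n}" "real (card S) \<le> \<theta> * real n"
    "\<And>y. \<exists>z. (\<forall>i. i \<notin> S \<longrightarrow> z i = 0) \<and>
      bilin n G (\<lambda>i. y i + z i) (\<lambda>i. y i + z i) \<le>
      8 * (trace_sum n G / real n) / \<theta> * (\<Sum>i<n. (y i)\<^sup>2)"
proof -
  let ?h = "trace_sum n G"
  define k where "k = nat \<lfloor>\<theta> * real n\<rfloor>"
  have tn: "0 < \<theta> * real n" using \<theta> n by simp
  have h0: "0 \<le> ?h" by (rule psd_trace_nonneg[OF G])
  show ?thesis
  proof (cases "0 < k \<and> 0 < ?h")
    case True
    obtain S where S: "S \<subseteq> {..<n}" "card S \<le> k"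
      and sel: "\<And>y. \<exists>z. (\<forall>i. i \<notin> S \<longrightarrow> z i = 0) \<and>
        bilin n G (\<lambda>i. y i + z i) (\<lambda>i. y i + z i) \<le> 4 * ?h / real k * (\<Sum>i<n. (y i)\<^sup>2)"
      using True by (auto intro: schur_complement_selection[OF G, of ?h k])
    \<comment> \<open>Rounding down loses at most a factor 2, because \<open>k\<close> is at least
      1; this turns the constant 4 into 8.\<close>
    have k: "real k \<le> \<theta> * real n" "\<theta> * real n < 2 * real k"
      using True tn unfolding k_def by linarith+
    have "4 * ?h / real k \<le> 4 * ?h / (\<theta> * real n / 2)"
      using k(2) tn h0 by (intro divide_left_mono) auto
    also have "\<dots> = 8 * (?h / real n) / \<theta>" by simp
    finally have "4 * ?h / real k * (\<Sum>i<n. (y i)\<^sup>2) \<le> 8 * (?h / real n) / \<theta> * (\<Sum>i<n. (y i)\<^sup>2)"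
      for y :: "nat \<Rightarrow> real"
      by (rule mult_right_mono) (simp add: sum_nonneg)
    with sel have "\<exists>z. (\<forall>i. i \<notin> S \<longrightarrow> z i = 0) \<and>
        bilin n G (\<lambda>i. y i + z i) (\<lambda>i. y i + z i) \<le> 8 * (?h / real n) / \<theta> * (\<Sum>i<n. (y i)\<^sup>2)" for y
      by (meson order_trans)
    then show ?thesis
      using S k(1) by (intro that[of S]) auto
  next
    case False
    \<comment> \<open>Here \<open>S\<close> is empty: either the trace is zero or
      \<open>\<theta> n < 1\<close>, and then \<open>bilin_le_trace\<close> alone is strong
      enough.\<close>
    have "?h \<le> 8 * (?h / real n) / \<theta>"
    proof (cases "?h = 0")
      case False
      with h0 \<open>\<not> (0 < k \<and> 0 < ?h)\<close> have "k = 0" by simp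
      then have "\<theta> * real n < 1" unfolding k_def by linarith
      then have "?h * (\<theta> * real n) \<le> ?h * 8"
        using h0 by (intro mult_left_mono) auto
      then show ?thesis using \<theta> n by (simp add: field_simps)
    qed simp
    then have "bilin n G y y \<le> 8 * (?h / real n) / \<theta> * (\<Sum>i<n. (y i)\<^sup>2)" for y
      using bilin_le_trace[OF G, of y] by (meson mult_right_mono order_trans sum_nonneg zero_le_power2)
    then show ?thesis
      using tn by (intro that[of "{}"]) (auto intro!: exI[of _ "\<lambda>_. 0"])
  qed
qed

subsection \<open>Ellipsoids and the sphere\<close>

definition gram :: "real mat \<Rightarrow> nat \<Rightarrow> nat \<Rightarrow> real" where
  "gram A i j = col A i \<bullet> col A j"

lemma scalar_prod_mult_mat_vec:
  assumes A: "A \<in> carrier_mat m n"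
  shows "(A *\<^sub>v Matrix.vec n x) \<bullet> (A *\<^sub>v Matrix.vec n x) = bilin n (gram A) x x"
proof -
  have "(A *\<^sub>v Matrix.vec n x) \<bullet> (A *\<^sub>v Matrix.vec n x) =
      (\<Sum>r = 0..<m. (\<Sum>i = 0..<n. A $$ (r, i) * x i) * (\<Sum>j = 0..<n. A $$ (r, j) * x j))"
    using A by (simp add: scalar_prod_def)
  also have "\<dots> = (\<Sum>r = 0..<m. \<Sum>i = 0..<n. \<Sum>j = 0..<n. (A $$ (r, i) * x i) * (A $$ (r, j) * x j))"
    by (simp add: sum_product)
  also have "\<dots> = (\<Sum>i = 0..<n. \<Sum>r = 0..<m. \<Sum>j = 0..<n. (A $$ (r, i) * x i) * (A $$ (r, j) * x j))"
    by (rule sum.swap)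
  also have "\<dots> = (\<Sum>i = 0..<n. \<Sum>j = 0..<n. \<Sum>r = 0..<m. (A $$ (r, i) * x i) * (A $$ (r, j) * x j))"
    by (intro sum.cong refl sum.swap)
  also have "\<dots> = (\<Sum>i = 0..<n. \<Sum>j = 0..<n. gram A i j * x i * x j)"
    using A by (intro sum.cong refl) (simp add: gram_def scalar_prod_def sum_distrib_left sum_distrib_right mult_ac)
  finally show ?thesis
    by (simp add: bilin_def lessThan_atLeast0)
qed

lemma scalar_prod_self_nonneg: "0 \<le> v \<bullet> v" for v :: "real Matrix.vec"
  by (simp add: scalar_prod_def sum_nonneg)

lemma psd_gram: "A \<in> carrier_mat m n \<Longrightarrow> psd n (gram A)"
  unfolding psd_def
proof (intro conjI allI)
  show "gram A i j = gram A j i" for i j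
    unfolding gram_def by (rule comm_scalar_prod[of _ "dim_row A"]) auto
qed (metis scalar_prod_mult_mat_vec scalar_prod_self_nonneg)

lemma gauge_norm_ellipsoid:
  assumes T: "T \<in> carrier_mat n n" and x: "x \<in> carrier_vec n"
  shows "gauge_norm {x \<in> carrier_vec n. T *\<^sub>v x \<in> unit_ball n} x = vnorm (T *\<^sub>v x)"
proof -
  let ?v = "vnorm (T *\<^sub>v x)"
  have norm_smult: "vnorm (T *\<^sub>v (c \<cdot>\<^sub>v y)) = c * vnorm (T *\<^sub>v y)" if "0 \<le> c" "y \<in> carrier_vec n" for c y
    using that T by (simp add: mult_mat_vec vnorm_def real_sqrt_mult mult.assoc[symmetric])
  have v0: "0 \<le> ?v" by (simp add: vnorm_def scalar_prod_self_nonneg)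
  have "(\<exists>y\<in>{x \<in> carrier_vec n. T *\<^sub>v x \<in> unit_ball n}. x = t \<cdot>\<^sub>v y) \<longleftrightarrow> ?v \<le> t" if t: "0 < t" for t
  proof
    assume "\<exists>y\<in>{x \<in> carrier_vec n. T *\<^sub>v x \<in> unit_ball n}. x = t \<cdot>\<^sub>v y"
    then obtain y where "y \<in> carrier_vec n" "vnorm (T *\<^sub>v y) \<le> 1" "x = t \<cdot>\<^sub>v y"
      by (auto simp: unit_ball_def)
    then show "?v \<le> t" using t by (simp add: norm_smult)
  next
    assume "?v \<le> t"
    then show "\<exists>y\<in>{x \<in> carrier_vec n. T *\<^sub>v x \<in> unit_ball n}. x = t \<cdot>\<^sub>v y"
      using t x T by (intro bexI[of _ "(1 / t) \<cdot>\<^sub>v x"])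
        (auto simp: unit_ball_def norm_smult smult_smult_assoc)
  qed
  then have eq: "{t. 0 < t \<and> (\<exists>y\<in>{x \<in> carrier_vec n. T *\<^sub>v x \<in> unit_ball n}. x = t \<cdot>\<^sub>v y)} = {t. 0 < t \<and> ?v \<le> t}"
    by blast
  show ?thesis
    unfolding gauge_norm_def eq
  proof (rule cInf_eq_non_empty)
    show "{t. 0 < t \<and> ?v \<le> t} \<noteq> {}" using v0 by (auto intro!: exI[of _ "?v + 1"])
    \<comment> \<open>For \<open>?v = 0\<close> the infimum is not attained, hence the approach from
      above.\<close>
    show "y \<le> ?v" if "\<And>t. t \<in> {t. 0 < t \<and> ?v \<le> t} \<Longrightarrow> y \<le> t" for y
    proof (rule dense_ge)
      fix t assume "?v < t"
      with v0 show "y \<le> t" by (intro that) simp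
    qed
  qed auto
qed

section \<open>Second moments on the sphere and the value of \<open>M_norm\<close>\<close>

lemma integral_sphere_rotation:
  assumes n: "0 < n" and U: "rotation n U" and f: "f \<in> borel_measurable (sphere_measure n)"
  shows "(LINT x|sphere_measure n. f (U *\<^sub>v x)) = (LINT x|sphere_measure n. (f x :: real))"
proof -
  have UC: "U \<in> carrier_mat n n" using U by (simp add: rotation_def)
  have "(*\<^sub>v) U \<in> restrict_space (lborel_vec n) (unit_sphere n) \<rightarrow>\<^sub>M restrict_space (lborel_vec n) (unit_sphere n)"
    using measurable_mult_mat_vec[OF UC measurable_ident_sets[OF refl]] UC vnorm_rotation[OF U]
    by (intro measurable_restrict_space3) (auto simp: unit_sphere_def)
  then have m: "(*\<^sub>v) U \<in> sphere_measure n \<rightarrow>\<^sub>M sphere_measure n"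
    by (simp add: sphere_measure_def)
  have "(LINT x|sphere_measure n. f x) = (LINT x|distr (sphere_measure n) (sphere_measure n) ((*\<^sub>v) U). f x)"
    by (simp add: sphere_measure(4)[OF n U])
  also have "\<dots> = (LINT x|sphere_measure n. f (U *\<^sub>v x))"
    by (rule integral_distr[OF m f])
  finally show ?thesis ..
qed

lemma sphere_index_measurable:
  "i < n \<Longrightarrow> (\<lambda>x. x $ i) \<in> borel_measurable (sphere_measure n)"
  unfolding sphere_measure_def
  using measurable_restrict_space1[OF measurable_vec_index] by simp

lemma unit_sphere_index_le:
  assumes "x \<in> unit_sphere n" "i < n"
  shows "\<bar>x $ i\<bar> \<le> 1"
proof -
  have "(x $ i)\<^sup>2 \<le> (\<Sum>j = 0..<n. (x $ j)\<^sup>2)"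
    using assms(2) by (intro member_le_sum) auto
  also have "\<dots> = x \<bullet> x"
    using assms(1) by (auto simp: unit_sphere_def scalar_prod_def power2_eq_square)
  also have "\<dots> = 1"
    using assms(1) by (simp add: unit_sphere_def vnorm_def)
  finally show ?thesis by (simp add: abs_square_le_1)
qed

lemma sphere_index_mult_integrable:
  assumes n: "0 < n" and "i < n" "j < n"
  shows "integrable (sphere_measure n) (\<lambda>x. x $ i * x $ j)"
proof -
  interpret prob_space "sphere_measure n" by (rule sphere_measure(1)[OF n])
  show ?thesis
  proof (rule integrable_const_bound[where B = 1])
    show "AE x in sphere_measure n. norm (x $ i * x $ j) \<le> 1"
      using unit_sphere_index_le assms
      by (intro AE_I2) (simp add: sphere_measure(2)[OF n] abs_mult mult_le_one)
  qed (intro borel_measurable_times sphere_index_measurable assms)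
qed

text \<open>The rotation \<open>x\<^sub>i \<mapsto> - x\<^sub>j, x\<^sub>j \<mapsto> x\<^sub>i\<close> at once kills the mixed moments and equates the pure ones.\<close>

lemma sphere_quarter_turn:
  assumes ij: "i < n" "j < n" "i \<noteq> j"
  obtains U where "rotation n U"
    "\<And>x. x \<in> carrier_vec n \<Longrightarrow> (U *\<^sub>v x) $ i = - x $ j"
    "\<And>x. x \<in> carrier_vec n \<Longrightarrow> (U *\<^sub>v x) $ j = x $ i"
proof -
  let ?p = "Transposition.transpose i j"
  let ?s = "\<lambda>r. if r = i then -1 else 1 :: real"
  define U where "U = Matrix.mat n n (\<lambda>(r, c). if c = ?p r then ?s r else 0)"
  have p: "?p r < n" if "r < n" for r
    using that ij by (auto simp: Transposition.transpose_def)
  \<comment> \<open>Since \<open>?p\<close> is an involution, the only nonzero entry of column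
    \<open>a\<close> sits in row \<open>?p a\<close>, and the sums below collapse to one
    term.\<close>
  have flip: "a = ?p r \<longleftrightarrow> r = ?p a" and inj: "?p a = ?p r \<longleftrightarrow> a = r" for a r
    by (auto simp: Transposition.transpose_def)
  have UC: "U \<in> carrier_mat n n" by (simp add: U_def)
  have Ux: "(U *\<^sub>v x) $ r = ?s r * x $ ?p r" if "x \<in> carrier_vec n" "r < n" for x r
  proof -
    have "(U *\<^sub>v x) $ r = (\<Sum>c = 0..<n. (if c = ?p r then ?s r else 0) * x $ c)"
      using that by (simp add: U_def scalar_prod_def)
    also have "\<dots> = ?s r * x $ ?p r"
      using p[OF that(2)] by (subst sum.remove[of _ "?p r"]) (auto intro!: sum.neutral)
    finally show ?thesis .
  qed
  have "transpose_mat U * U = 1\<^sub>m n"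
  proof (rule eq_matI)
    fix a b assume "a < dim_row (1\<^sub>m n :: real mat)" "b < dim_col (1\<^sub>m n :: real mat)"
    then have ab: "a < n" "b < n" by auto
    have "(transpose_mat U * U) $$ (a, b) =
        (\<Sum>r = 0..<n. (if r = ?p a then ?s r else 0) * (if r = ?p b then ?s r else 0))"
      using ab by (simp add: U_def scalar_prod_def flip[of a] flip[of b])
    also have "\<dots> = (if b = a then 1 else 0)"
      using p[OF ab(1)] by (subst sum.remove[of _ "?p a"]) (auto intro!: sum.neutral simp: inj)
    finally show "(transpose_mat U * U) $$ (a, b) = 1\<^sub>m n $$ (a, b)"
      using ab by simp
  qed (use UC in auto)
  then have "rotation n U" using UC by (simp add: rotation_def)
  then show ?thesis
    using ij Ux by (intro that[of U]) auto
qed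

text \<open>Quarter turns make the mixed moments vanish and the \<open>n\<close> pure ones equal;
  the latter sum to the mean of \<open>|x|^2 = 1\<close>.\<close>

lemma sphere_second_moment:
  assumes ij: "i < n" "j < n"
  shows "(LINT x|sphere_measure n. x $ i * x $ j) = (if i = j then 1 / real n else 0)"
proof -
  have n: "0 < n" using ij by simp
  interpret prob_space "sphere_measure n" by (rule sphere_measure(1)[OF n])
  let ?E = "\<lambda>i j. LINT x|sphere_measure n. x $ i * x $ j"
  have carr: "x \<in> carrier_vec n" if "x \<in> space (sphere_measure n)" for x
    using that by (simp add: sphere_measure(2)[OF n] unit_sphere_def)
  have moments: "?E a b = 0 \<and> ?E a a = ?E b b" if ab: "a < n" "b < n" "a \<noteq> b" for a b
  proof -
    obtain U where U: "rotation n U"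
      "\<And>x. x \<in> carrier_vec n \<Longrightarrow> (U *\<^sub>v x) $ a = - x $ b"
      "\<And>x. x \<in> carrier_vec n \<Longrightarrow> (U *\<^sub>v x) $ b = x $ a"
      by (rule sphere_quarter_turn[OF ab]) (rule that)
    have rot: "(LINT x|sphere_measure n. (U *\<^sub>v x) $ c * (U *\<^sub>v x) $ d) = ?E c d" if "c < n" "d < n" for c d
      using that by (intro integral_sphere_rotation[OF n U(1), of "\<lambda>x. x $ c * x $ d"]
          borel_measurable_times sphere_index_measurable)
    have "?E a b = (LINT x|sphere_measure n. - (x $ a * x $ b))"
      unfolding rot[OF ab(1,2), symmetric]
      by (rule Bochner_Integration.integral_cong) (simp_all add: U(2,3) carr)
    then have "?E a b = 0" by simp
    moreover have "?E a a = ?E b b"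
      unfolding rot[OF ab(1,1), symmetric]
      by (rule Bochner_Integration.integral_cong) (simp_all add: U(2,3) carr)
    ultimately show ?thesis ..
  qed
  show ?thesis
  proof (cases "i = j")
    case False
    then show ?thesis using moments[OF ij] by simp
  next
    case True
    have "1 = (LINT x|sphere_measure n. (1 :: real))"
      by (simp add: prob_space)
    also have "\<dots> = (LINT x|sphere_measure n. (\<Sum>k<n. x $ k * x $ k))"
    proof (rule Bochner_Integration.integral_cong[OF refl])
      fix x assume "x \<in> space (sphere_measure n)"
      then have "x \<in> carrier_vec n" "x \<bullet> x = 1"
        by (auto simp: sphere_measure(2)[OF n] unit_sphere_def vnorm_def)
      then show "1 = (\<Sum>k<n. x $ k * x $ k)"
        by (simp add: scalar_prod_def lessThan_atLeast0)
    qed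
    also have "\<dots> = (\<Sum>k<n. ?E k k)"
      by (rule Bochner_Integration.integral_sum) (auto intro: sphere_index_mult_integrable[OF n])
    also have "\<dots> = (\<Sum>k<n. ?E i i)"
      using moments[OF ij(1)] by (intro sum.cong refl) (metis lessThan_iff)
    finally show ?thesis
      using True n by (simp add: field_simps)
  qed
qed

lemma sphere_mean_mult_mat_vec:
  assumes A: "A \<in> carrier_mat n n" and n: "0 < n"
  shows "(LINT x|sphere_measure n. (A *\<^sub>v x) \<bullet> (A *\<^sub>v x)) = trace_sum n (gram A) / real n"
proof -
  let ?E = "\<lambda>i j. LINT x|sphere_measure n. x $ i * x $ j"
  have "(LINT x|sphere_measure n. (A *\<^sub>v x) \<bullet> (A *\<^sub>v x)) =
      (LINT x|sphere_measure n. (\<Sum>i<n. \<Sum>j<n. gram A i j * (x $ i * x $ j)))"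
  proof (rule Bochner_Integration.integral_cong[OF refl])
    fix x assume "x \<in> space (sphere_measure n)"
    then have "x \<in> carrier_vec n"
      by (simp add: sphere_measure(2)[OF n] unit_sphere_def)
    then have "Matrix.vec n (($) x) = x" by auto
    then show "(A *\<^sub>v x) \<bullet> (A *\<^sub>v x) = (\<Sum>i<n. \<Sum>j<n. gram A i j * (x $ i * x $ j))"
      using scalar_prod_mult_mat_vec[OF A, of "($) x"] by (simp add: bilin_def mult.assoc)
  qed
  also have "\<dots> = (\<Sum>i<n. LINT x|sphere_measure n. (\<Sum>j<n. gram A i j * (x $ i * x $ j)))"
    by (intro Bochner_Integration.integral_sum Bochner_Integration.integrable_sum
        integrable_mult_right sphere_index_mult_integrable n) auto
  also have "\<dots> = (\<Sum>i<n. \<Sum>j<n. LINT x|sphere_measure n. gram A i j * (x $ i * x $ j))"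
    by (intro sum.cong refl Bochner_Integration.integral_sum
        integrable_mult_right sphere_index_mult_integrable n) auto
  also have "\<dots> = (\<Sum>i<n. \<Sum>j<n. gram A i j * ?E i j)"
    by simp
  also have "\<dots> = (\<Sum>i<n. \<Sum>j<n. if i = j then gram A i j / real n else 0)"
    by (intro sum.cong refl) (simp add: sphere_second_moment)
  finally show ?thesis
    by (simp add: trace_sum_def sum_divide_distrib)
qed

text \<open>Rotating the variable by \<open>U\<close> leaves the mean of \<open>|T x|^2\<close>
  unchanged and replaces \<open>T\<close> by \<open>T * U\<close>. When the columns of
  \<open>U\<close> are the given basis, the trace is that of the Gram matrix of the vectors
  \<open>T e_i\<close>.\<close>

lemma M_norm_ellipsoid:
  assumes T: "T \<in> carrier_mat n n" and n: "0 < n" and U: "rotation n U"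
  shows "(M_norm n {x \<in> carrier_vec n. T *\<^sub>v x \<in> unit_ball n})\<^sup>2 = trace_sum n (gram (T * U)) / real n"
proof -
  let ?f = "\<lambda>x. (T *\<^sub>v x) \<bullet> (T *\<^sub>v x)"
  have UC: "U \<in> carrier_mat n n" using U by (simp add: rotation_def)
  have carr: "x \<in> carrier_vec n" if "x \<in> space (sphere_measure n)" for x
    using that by (simp add: sphere_measure(2)[OF n] unit_sphere_def)
  have "?f \<in> borel_measurable (restrict_space (lborel_vec n) (unit_sphere n))"
    using measurable_mult_mat_vec[OF T measurable_ident_sets[OF refl]]
    by (intro measurable_restrict_space1 measurable_scalar_prod[of _ _ n]) simp_all
  then have f: "?f \<in> borel_measurable (sphere_measure n)"
    by (simp add: sphere_measure_def)
  have "(LINT x|sphere_measure n. (gauge_norm {x \<in> carrier_vec n. T *\<^sub>v x \<in> unit_ball n} x)\<^sup>2) =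
      (LINT x|sphere_measure n. ?f x)"
    by (rule Bochner_Integration.integral_cong)
      (simp_all add: gauge_norm_ellipsoid[OF T] carr vnorm_def scalar_prod_self_nonneg)
  also have "\<dots> = (LINT x|sphere_measure n. ?f (U *\<^sub>v x))"
    by (rule integral_sphere_rotation[OF n U f, symmetric])
  also have "\<dots> = (LINT x|sphere_measure n. ((T * U) *\<^sub>v x) \<bullet> ((T * U) *\<^sub>v x))"
    using T UC by (intro Bochner_Integration.integral_cong refl) (simp add: carr)
  also have "\<dots> = trace_sum n (gram (T * U)) / real n"
    using T UC n by (intro sphere_mean_mult_mat_vec) auto
  finally have "M_norm n {x \<in> carrier_vec n. T *\<^sub>v x \<in> unit_ball n} = sqrt (trace_sum n (gram (T * U)) / real n)"
    by (simp add: M_norm_def)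
  then show ?thesis
    using psd_trace_nonneg[OF psd_gram[of "T * U" n n]] T UC by simp
qed

section \<open>Coordinate projections and the inclusion\<close>

text \<open>Two candidates for the definite description differ by a vector of the subspace that is
  orthogonal to itself.\<close>

lemma orth_proj_coord_subspace:
  assumes e: "orthonormal_basis n e" and w: "w \<in> carrier_vec n" and y: "y \<in> coord_subspace n e \<sigma>"
    and orth: "\<And>v. v \<in> coord_subspace n e \<sigma> \<Longrightarrow> (w - y) \<bullet> v = 0"
  shows "orth_proj (coord_subspace n e \<sigma>) w = y"
  unfolding orth_proj_def
proof (rule the_equality)
  show "y \<in> coord_subspace n e \<sigma> \<and> (\<forall>v\<in>coord_subspace n e \<sigma>. (w - y) \<bullet> v = 0)"
    using y orth by blast
  fix u assume u: "u \<in> coord_subspace n e \<sigma> \<and> (\<forall>v\<in>coord_subspace n e \<sigma>. (w - u) \<bullet> v = 0)"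
  have C: "u \<in> carrier_vec n" "y \<in> carrier_vec n" and ec: "\<And>j. j < n \<Longrightarrow> e j \<in> carrier_vec n"
    using u y e by (auto simp: coord_subspace_def orthonormal_basis_def)
  have "u - y \<in> coord_subspace n e \<sigma>"
    using u y C ec by (auto simp: coord_subspace_def minus_scalar_prod_distrib)
  then have "(w - y) \<bullet> (u - y) = 0" "(w - u) \<bullet> (u - y) = 0"
    using u orth by auto
  then have "(u - y) \<bullet> (u - y) = 0"
    using C w by (simp add: minus_scalar_prod_distrib[of _ n])
  then have "vnorm (u - y) = 0" by (simp add: vnorm_def)
  then have "u - y = 0\<^sub>v n"
    using vnorm_eq_0_iff[of "u - y" n] C by simp
  then have "(u - y) $ i = 0" if "i < n" for i using that by simp
  then show "u = y" using C by (intro eq_vecI) auto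
qed

theorem theoremB:
  "\<exists>c::real. c > 0 \<and>
    (\<forall>(n::nat) (E::real Matrix.vec set) (e::nat \<Rightarrow> real Matrix.vec) (\<theta>::real).
      n \<ge> 1 \<longrightarrow> ellipsoid n E \<longrightarrow> orthonormal_basis n e \<longrightarrow> 0 < \<theta> \<longrightarrow> \<theta> < 1 \<longrightarrow>
      (\<exists>\<sigma> \<subseteq> {..<n}. real (card \<sigma>) \<ge> (1 - \<theta>) * real n \<and>
        (\<lambda>x. (c * sqrt \<theta> / (sqrt (ln (2 / \<theta>)) * M_norm n E)) \<cdot>\<^sub>v x) ` coord_ball n e \<sigma>
          \<subseteq> orth_proj (coord_subspace n e \<sigma>) ` E))"
proof (intro exI[of _ "1 / 4 :: real"] conjI allI impI)
  fix n :: nat and E :: "real Matrix.vec set" and e :: "nat \<Rightarrow> real Matrix.vec" and \<theta> :: real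
  assume "n \<ge> 1" and ell: "ellipsoid n E" and e: "orthonormal_basis n e" and \<theta>: "0 < \<theta>" "\<theta> < 1"
  then have n: "0 < n" by simp
  obtain T where T: "T \<in> carrier_mat n n" and E: "E = {x \<in> carrier_vec n. T *\<^sub>v x \<in> unit_ball n}"
    using ell by (auto simp: ellipsoid_def)
  \<comment> \<open>The orthogonal matrix with columns \<open>e j\<close>; its transpose computes
    coordinates in this basis.\<close>
  define U where "U = Matrix.mat n n (\<lambda>(r, c). e c $ r)"
  have ec: "e j \<in> carrier_vec n" if "j < n" for j
    using e that by (auto simp: orthonormal_basis_def)
  have UC: "U \<in> carrier_mat n n" by (simp add: U_def)
  have col: "col U j = e j" if "j < n" for j
    using ec[OF that] that by (intro eq_vecI) (auto simp: U_def)
  have rot: "rotation n U"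
    unfolding rotation_def
  proof
    show "transpose_mat U * U = 1\<^sub>m n"
      using UC e by (intro eq_matI) (auto simp: col orthonormal_basis_def)
  qed (rule UC)
  have UTx: "(transpose_mat U *\<^sub>v x) $ i = x \<bullet> e i" if "x \<in> carrier_vec n" "i < n" for x i
    using that UC comm_scalar_prod[OF that(1) ec[OF that(2)]] by (simp add: col)
  let ?A = "T * U"
  have A: "?A \<in> carrier_mat n n" using T UC by simp
  define M where "M = M_norm n E"
  have M: "M\<^sup>2 = trace_sum n (gram ?A) / real n"
    unfolding M_def E by (rule M_norm_ellipsoid[OF T n rot])
  obtain S where S: "S \<subseteq> {..<n}" "real (card S) \<le> \<theta> * real n"
    and sel: "\<And>y. \<exists>z. (\<forall>i. i \<notin> S \<longrightarrow> z i = 0) \<and>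
      bilin n (gram ?A) (\<lambda>i. y i + z i) (\<lambda>i. y i + z i) \<le> 8 * M\<^sup>2 / \<theta> * (\<Sum>i<n. (y i)\<^sup>2)"
    using proportional_selection[OF psd_gram[OF A] \<theta>(1) n] unfolding M by blast
  \<comment> \<open>Shifts supported on \<open>S\<close> are exactly what the projection onto the
    remaining coordinates forgets.\<close>
  define \<sigma> where "\<sigma> = {..<n} - S"
  have "card \<sigma> = n - card S" "card S \<le> n"
    using S(1) card_mono[OF _ S(1)] unfolding \<sigma>_def
    by (simp_all add: card_Diff_subset finite_subset)
  then have card: "real (card \<sigma>) \<ge> (1 - \<theta>) * real n"
    using S(2) by (simp add: algebra_simps)
  define L where "L = ln (2 / \<theta>)"
  have "ln 2 \<le> L"
    unfolding L_def using \<theta> by (subst ln_le_cancel_iff) (auto simp: field_simps)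
  then have L: "1 / 2 \<le> L"
    using ln2_ge_two_thirds by linarith
  define r where "r = 1 / 4 * sqrt \<theta> / (sqrt L * M)"
  \<comment> \<open>The left side equals \<open>1 / (2 L)\<close> for nonzero \<open>M\<close>, so
    the constant 1/4 matches the lower bound 1/2 for \<open>L\<close>. For \<open>M = 0\<close>
    division by zero makes \<open>r\<close> zero.\<close>
  have r2: "8 * M\<^sup>2 / \<theta> * r\<^sup>2 \<le> 1"
    using L \<theta> by (cases "M = 0") (auto simp: r_def power_divide power_mult_distrib field_simps)
  have "(\<lambda>x. r \<cdot>\<^sub>v x) ` coord_ball n e \<sigma> \<subseteq> orth_proj (coord_subspace n e \<sigma>) ` E"
  proof
    fix u assume "u \<in> (\<lambda>x. r \<cdot>\<^sub>v x) ` coord_ball n e \<sigma>"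
    then obtain x where x: "x \<in> carrier_vec n" "x \<in> coord_subspace n e \<sigma>" "vnorm x \<le> 1" and u: "u = r \<cdot>\<^sub>v x"
      by (auto simp: coord_ball_def unit_ball_def)
    have uC: "u \<in> carrier_vec n" using x u by simp
    \<comment> \<open>The coordinates of \<open>u\<close> in the basis \<open>e\<close>, of the same
      Euclidean norm as \<open>u\<close>.\<close>
    define y where "y = ($) (transpose_mat U *\<^sub>v u)"
    have vy: "Matrix.vec n y = transpose_mat U *\<^sub>v u"
      using UC by (intro eq_vecI) (auto simp: y_def)
    have Uy: "U *\<^sub>v Matrix.vec n y = u"
      using UC uC rotation_mult_transpose[OF rot]
      by (simp add: vy assoc_mult_mat_vec[of U n n "transpose_mat U" n, symmetric])
    have "(\<Sum>i<n. (y i)\<^sup>2) = Matrix.vec n y \<bullet> Matrix.vec n y"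
      by (simp add: scalar_prod_def lessThan_atLeast0 power2_eq_square)
    also have "\<dots> = (vnorm u)\<^sup>2"
      using vnorm_rotation[OF rotation_transpose[OF rot] uC]
      by (simp add: vy vnorm_def scalar_prod_self_nonneg)
    also have "\<dots> = r\<^sup>2 * (vnorm x)\<^sup>2"
      using x(1) by (simp add: u vnorm_def scalar_prod_self_nonneg power2_eq_square mult.assoc[symmetric])
    also have "\<dots> \<le> r\<^sup>2 * 1"
      using x(3) by (intro mult_left_mono power_le_one) (auto simp: vnorm_def scalar_prod_self_nonneg)
    finally have y2: "8 * M\<^sup>2 / \<theta> * (\<Sum>i<n. (y i)\<^sup>2) \<le> 8 * M\<^sup>2 / \<theta> * r\<^sup>2"
      using \<theta> by (intro mult_left_mono) auto
    obtain z where z: "\<And>i. i \<notin> S \<Longrightarrow> z i = 0"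
      and yz: "bilin n (gram ?A) (\<lambda>i. y i + z i) (\<lambda>i. y i + z i) \<le> 1"
      using sel[of y] y2 r2 by (meson order_trans)
    \<comment> \<open>The preimage of \<open>u\<close>: adding \<open>z\<close> in the coordinates
      of \<open>S\<close> brings the point into \<open>E\<close>, while \<open>w - u\<close> stays
      orthogonal to the coordinate subspace of \<open>\<sigma>\<close>.\<close>
    define w where "w = U *\<^sub>v Matrix.vec n (\<lambda>i. y i + z i)"
    have wC: "w \<in> carrier_vec n" using UC by (simp add: w_def)
    have "(T *\<^sub>v w) \<bullet> (T *\<^sub>v w) \<le> 1"
      using yz T UC unfolding w_def scalar_prod_mult_mat_vec[OF A, symmetric]
      by (simp add: assoc_mult_mat_vec[of T n n U n])
    then have wE: "w \<in> E"
      using wC T by (simp add: E unit_ball_def vnorm_def)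
    have "orth_proj (coord_subspace n e \<sigma>) w = u"
    proof (rule orth_proj_coord_subspace[OF e wC])
      show "u \<in> coord_subspace n e \<sigma>"
        using x ec by (auto simp: coord_subspace_def u)
      fix v assume v: "v \<in> coord_subspace n e \<sigma>"
      then have vC: "v \<in> carrier_vec n" by (simp add: coord_subspace_def)
      have "Matrix.vec n (\<lambda>i. y i + z i) = Matrix.vec n y + Matrix.vec n z"
        by auto
      then have "w = u + U *\<^sub>v Matrix.vec n z"
        using UC Uy by (simp add: w_def mult_add_distrib_mat_vec[OF UC])
      then have wu: "w - u = U *\<^sub>v Matrix.vec n z"
        using UC uC by (intro eq_vecI) auto
      have "(w - u) \<bullet> v = v \<bullet> (U *\<^sub>v Matrix.vec n z)"
        unfolding wu using vC UC by (intro comm_scalar_prod[of _ n]) auto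
      also have "\<dots> = (transpose_mat U *\<^sub>v v) \<bullet> Matrix.vec n z"
        using UC vC by (intro transpose_vec_mult_scalar[symmetric]) auto
      also have "\<dots> = (\<Sum>i = 0..<n. (v \<bullet> e i) * z i)"
        unfolding scalar_prod_def[of _ "Matrix.vec n z"] using UTx[OF vC] by (intro sum.cong) auto
      also have "\<dots> = 0"
        using v z by (intro sum.neutral) (auto simp: coord_subspace_def \<sigma>_def)
      finally show "(w - u) \<bullet> v = 0" .
    qed
    then show "u \<in> orth_proj (coord_subspace n e \<sigma>) ` E"
      using wE by blast
  qed
  then show "\<exists>\<sigma>\<subseteq>{..<n}. real (card \<sigma>) \<ge> (1 - \<theta>) * real n \<and>
      (\<lambda>x. (1 / 4 * sqrt \<theta> / (sqrt (ln (2 / \<theta>)) * M_norm n E)) \<cdot>\<^sub>v x) ` coord_ball n e \<sigma>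
        \<subseteq> orth_proj (coord_subspace n e \<sigma>) ` E"
    using card by (intro exI[of _ \<sigma>]) (auto simp: \<sigma>_def r_def L_def M_def)
qed simp

end
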